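(* There is a constant $C\ge 2$ such that the following holds for all $a>0$ and all $R>Ca$. For every $(\mathbf{x}^\circ,\mathbf{y}_1^\circ,\mathbf{y}_2^\circ),(\mathbf{x}^f,\mathbf{y}_1^f,\mathbf{y}_2^f)\in\mathcal{S}_R^{1+2}$ there exist $T>0$ and a control $\mathbf{u}\in L^\infty([0,T];\mathbb{R}^3)$ such that the system $$\begin{cases}\dot{\mathbf{x}}(t)=\mathbf{u}(t),\\[1mm] \displaystyle\dot{\mathbf{y}}_1(t)=\frac{3a}{4}\left(\frac{1}{|\mathbf{d}_1(t)|}\mathbb{I}+\frac{1}{|\mathbf{d}_1(t)|^3}\,\mathbf{d}_1(t)\otimes\mathbf{d}_1(t)\right)\mathbf{u}(t),\\[3mm] \displaystyle\dot{\mathbf{y}}_2(t)=\frac{3a}{4}\left(\frac{1}{|\mathbf{d}_2(t)|}\mathbb{I}+\frac{1}{|\mathbf{d}_2(t)|^3}\,\mathbf{d}_2(t)\otimes\mathbf{d}_2(t)\right)\mathbf{u}(t),\end{cases}\qquad \mathbf{d}_j(t)=\mathbf{y}_j(t)-\mathbf{x}(t)\ \ (j=1,2),$$ admits a unique solution $(\mathbf{x},\mathbf{y}_1,\mathbf{y}_2)\in AC([0,T];\mathcal{S}_R^{1+2})$ with $(\mathbf{x}(0),\mathbf{y}_1(0),\mathbf{y}_2(0))=(\mathbf{x}^\circ,\mathbf{y}_1^\circ,\mathbf{y}_2^\circ)$, and this solution satisfies $(\mathbf{x}(T),\mathbf{y}_1(T),\mathbf{y}_2(T))=(\mathbf{x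}^f,\mathbf{y}_1^f,\mathbf{y}_2^f)$.
   Context: Here $\mathbf{x}(t)\in\mathbb{R}^3$ is the position of one active (controlled) spherical particle and $\mathbf{y}_1(t),\mathbf{y}_2(t)\in\mathbb{R}^3$ are the positions of two passive ones, all of radius $a>0$. $\mathbb{I}$ is the $3\times 3$ identity matrix and $\mathbf{d}\otimes\mathbf{d}=\mathbf{d}\mathbf{d}^\top$. For $R>0$, $$\mathcal{S}_R^{1+2}=\{(\mathbf{x},\mathbf{y}_1,\mathbf{y}_2)\in(\mathbb{R}^3)^3:\ |\mathbf{x}-\mathbf{y}_1|>R,\ |\mathbf{x}-\mathbf{y}_2|>R,\ |\mathbf{y}_1-\mathbf{y}_2|>R\}$$ is the set of well-separated configurations. $AC([0,T];\mathcal{S}_R^{1+2})$ is the set of absolutely continuous curves $[0,T]\to\mathbb{R}^9$ taking values in $\mathcal{S}_R^{1+2}$ for all $t\in[0,T]$; the differential equation is required to hold for almost every $t\in[0,T]$. *)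

theory Defs
  imports "HOL-Analysis.Analysis"
begin

type_synonym config = "(real^3) \<times> (real^3) \<times> (real^3)"

text \<open>The interval family may contain degenerate intervals, which contribute nothing to either sum.\<close>

definition absolutely_continuous_on :: "real set \<Rightarrow> (real \<Rightarrow> 'a::metric_space) \<Rightarrow> bool"
  where "absolutely_continuous_on S f \<longleftrightarrow>
    (\<forall>\<epsilon>>0. \<exists>\<delta>>0. \<forall>(n::nat) l r.
      (\<forall>i<n. l i \<le> r i \<and> {l i..r i} \<subseteq> S) \<and>
      (\<forall>i<n. \<forall>j<n. i \<noteq> j \<longrightarrow> {l i<..<r i} \<inter> {l j<..<r j} = {}) \<and>
      (\<Sum>i<n. r i - l i) < \<delta>
      \<longrightarrow> (\<Sum>i<n. dist (f (l i)) (f (r i))) < \<epsilon>)"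

definition separated :: "real \<Rightarrow> config set"
  where "separated R =
    {(x, y1, y2). norm (x - y1) > R \<and> norm (x - y2) > R \<and> norm (y1 - y2) > R}"

text \<open>Elements of \<open>AC([0,T]; A)\<close> and of \<open>L\<^sup>\<infinity>([0,T])\<close> are represented by functions on
  the whole real line whose values outside \<open>[0,T]\<close> are irrelevant.\<close>

definition AC :: "real \<Rightarrow> 'a::metric_space set \<Rightarrow> (real \<Rightarrow> 'a) set"
  where "AC T A = {z. absolutely_continuous_on {0..T} z \<and> (\<forall>t\<in>{0..T}. z t \<in> A)}"

definition L_infty :: "real \<Rightarrow> (real \<Rightarrow> 'a::euclidean_space) set"
  where "L_infty T = {u. u \<in> borel_measurable (lebesgue_on {0..T}) \<and>
    (\<exists>M. AE t in lebesgue_on {0..T}. norm (u t) \<le> M)}"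

definition tensor :: "real^'n \<Rightarrow> real^'n \<Rightarrow> real^'n^'n"  (infixl "\<otimes>\<^sub>v" 75)
  where "d \<otimes>\<^sub>v e = columnvector d ** (rowvector e :: real^'n^1)"

definition mobility :: "real \<Rightarrow> real^3 \<Rightarrow> real^3^3"
  where "mobility a d =
    (3 * a / 4) *\<^sub>R ((1 / norm d) *\<^sub>R mat 1 + (1 / norm d ^ 3) *\<^sub>R (d \<otimes>\<^sub>v d))"

definition is_solution ::
    "real \<Rightarrow> real \<Rightarrow> real \<Rightarrow> (real \<Rightarrow> real^3) \<Rightarrow> config \<Rightarrow>
     (real \<Rightarrow> real^3) \<Rightarrow> (real \<Rightarrow> real^3) \<Rightarrow> (real \<Rightarrow> real^3) \<Rightarrow> bool"
  where "is_solution a R T u z0 x y1 y2 \<longleftrightarrow>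
    (\<lambda>t. (x t, y1 t, y2 t)) \<in> AC T (separated R) \<and>
    (x 0, y1 0, y2 0) = z0 \<and>
    (AE t in lebesgue_on {0..T}.
      (x has_vector_derivative u t) (at t within {0..T}) \<and>
      (y1 has_vector_derivative mobility a (y1 t - x t) *v u t) (at t within {0..T}) \<and>
      (y2 has_vector_derivative mobility a (y2 t - x t) *v u t) (at t within {0..T}))"

end

theory Submission
  imports Defs
begin

text \<open>The system has three controls for nine unknowns, so steering must come from Lie brackets. With
\<open>e = 3 * a / 4\<close> a constant control \<open>v\<close> moves the configuration along the field
\<open>X\<^sub>v (x, y1, y2) = (v, S\<^sub>v (y1 - x), S\<^sub>v (y2 - x))\<close>, where \<open>S\<^sub>v d\<close> is the velocity that a point force along
\<open>v\<close> (a Stokeslet) induces at distance vector \<open>d\<close>. Call two configurations equivalent if finitely many such segments, run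
inside the separated configurations, lead from one to the other. Running a segment backwards is
again a segment, so this is an equivalence relation. The set of separated configurations is
connected (\<open>connected_separated\<close>), hence there is only one class as soon as every configuration is an
interior point of its class (\<open>reach_if_connected\<close>).

Openness of the classes is a form of the Chow--Rashevskii theorem, proved here without
expanding commutators of flows. A vector \<open>W\<close> is a tangent at \<open>z\<close> if some jointly continuous family of
reachable displacements has derivative \<open>(p, h) \<mapsto> h + p W\<close> at \<open>(0, z)\<close>. Following a flow, applying
such a family and flowing back shows that tangents are pulled back by flows; differentiating the
pullback at time zero shows that the span of the tangents is closed under brackets with
the control fields (\<open>bracket_in_span_tangents\<close>). If tangents span the whole space, composing the families of a
basis gives a map with derivative the identity, and a topological open mapping theorem for maps
differentiable at a single point finishes the argument (\<open>interior_orbit_if_full_span\<close>).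

For the Stokes fields all brackets are explicit. A bracket \<open>[X\<^sub>v, X\<^sub>v\<^sub>']\<close> fixes the active particle and
moves each passive one by a rotation-like velocity \<open>\<phi>(|d|) (v \<times> v') \<times> d\<close> (a rotlet). When \<open>2 e < R\<close> these fields,
their brackets with the \<open>X\<^sub>v\<close> and the \<open>X\<^sub>v\<close> themselves span all nine dimensions at every configuration that is not
collinear (\<open>noncollinear_dual_trivial\<close>); the brackets are computed exactly rather than to leading
order in \<open>e\<close>, and therefore \<open>C = 2\<close> works. A collinear configuration is equivalent to a non-collinear one, by
pushing the active particle sideways, and flows transport the property of being interior.

Uniqueness is Gronwall's inequality for absolutely continuous functions. It rests on the fact that
such a function with nonpositive derivative almost everywhere does not increase (\<open>absolutely_continuous_nonincreasing\<close>), and on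
the Lipschitz bound for the Stokeslet away from its singularity.\<close>

section \<open>Differential equations on the unit interval\<close>

text \<open>Picard iteration contracts because the time span is one and the Lipschitz constant is a half. The
short-time case is enough: a field run for a short time \<open>s\<close> is the field scaled by \<open>s\<close> and run for time one.
The iterates live among bounded continuous functions on the whole line, hence the clamp of the time variable to the interval.\<close>

lemma picard_unit_interval:
  fixes F :: "real \<Rightarrow> 'a::banach \<Rightarrow> 'a"
  assumes cont: "continuous_on ({0..1} \<times> UNIV) (\<lambda>(t, z). F t z)"
    and lip: "\<And>t y z. t \<in> {0..1} \<Longrightarrow> norm (F t y - F t z) \<le> norm (y - z) / 2"
  obtains c where "c 0 = z0"
    "\<And>t. t \<in> {0..1} \<Longrightarrow> (c has_vector_derivative F t (c t)) (at t within {0..1})"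
proof -
  define cl :: "real \<Rightarrow> real" where "cl t = max 0 (min 1 t)" for t
  have cl: "cl t \<in> {0..1}" for t by (auto simp: cl_def)
  have cont_cl: "continuous_on UNIV cl" unfolding cl_def by (intro continuous_intros)
  define h where "h c t = z0 + integral {0..t} (\<lambda>s. F s (apply_bcontfun c s))" for c t
  have contF: "continuous_on {0..1} (\<lambda>s. F s (apply_bcontfun c s))" for c
    by (rule continuous_on_compose2[OF cont, of _ "\<lambda>s. (s, apply_bcontfun c s)", simplified])
      (auto intro!: continuous_intros)
  have hd: "(h c has_vector_derivative F t (apply_bcontfun c t)) (at t within {0..1})"
    if "t \<in> {0..1}" for c t
    unfolding h_def
    using has_vector_derivative_add[OF has_vector_derivative_const
        integral_has_vector_derivative[OF contF that]] by simp
  have conth: "continuous_on {0..1} (h c)" for c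
    using hd by (rule continuous_on_vector_derivative)
  have hb: "(\<lambda>t. h c (cl t)) \<in> bcontfun" for c
  proof -
    have "continuous_on UNIV (\<lambda>t. h c (cl t))"
      by (rule continuous_on_compose2[OF conth cont_cl]) (use cl in auto)
    moreover have "bounded (range (\<lambda>t. h c (cl t)))"
    proof (rule bounded_subset)
      show "bounded (h c ` {0..1})"
        by (intro compact_imp_bounded compact_continuous_image conth) auto
    qed (use cl in auto)
    ultimately show ?thesis by (simp add: bcontfun_def)
  qed
  define P where "P c = Bcontfun (\<lambda>t. h c (cl t))" for c
  have P: "apply_bcontfun (P c) t = h c (cl t)" for c t
    unfolding P_def using hb by (simp add: Bcontfun_inverse)
  have "dist (P c) (P c') \<le> 1/2 * dist c c'" for c c'
  proof (rule dist_bound)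
    fix t
    have "norm (h c (cl t) - h c' (cl t)) =
        norm (integral {0..cl t} (\<lambda>s. F s (apply_bcontfun c s) - F s (apply_bcontfun c' s)))"
      unfolding h_def
      by (subst integral_diff)
        (use cl[of t] in \<open>auto intro!: integrable_continuous_real continuous_on_subset[OF contF]\<close>)
    also have "\<dots> \<le> integral {0..cl t} (\<lambda>s. 1/2 * dist c c')"
    proof (rule integral_norm_bound_integral)
      fix s assume "s \<in> {0..cl t}"
      then have "s \<in> {0..1}" using cl[of t] by auto
      from lip[OF this, of "apply_bcontfun c s" "apply_bcontfun c' s"] dist_bounded[of c s c']
      show "norm (F s (apply_bcontfun c s) - F s (apply_bcontfun c' s)) \<le> 1/2 * dist c c'"
        by (simp add: dist_norm)
    qed (use cl[of t] in \<open>auto intro!: integrable_continuous_real continuous_intros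
          continuous_on_subset[OF contF]\<close>)
    also have "\<dots> \<le> 1/2 * dist c c'"
      using cl[of t] by (auto intro!: mult_left_le_one_le)
    finally show "dist (apply_bcontfun (P c) t) (apply_bcontfun (P c') t) \<le> 1/2 * dist c c'"
      by (simp add: P dist_norm)
  qed
  then obtain c where c: "P c = c"
    using banach_fix_type[of "1/2" P] by auto
  have ceq: "apply_bcontfun c t = h c t" if "t \<in> {0..1}" for t
    using P[of c t] that by (simp add: c cl_def)
  show ?thesis
  proof
    show "apply_bcontfun c 0 = z0" by (simp add: ceq h_def)
    show "(apply_bcontfun c has_vector_derivative F t (apply_bcontfun c t)) (at t within {0..1})"
      if "t \<in> {0..1}" for t
      using has_vector_derivative_transform[OF that _ hd[OF that, of c]] ceq by auto
  qed
qed

text \<open>A Gronwall estimate that needs no exponential: at the maximum of the norm, the mean value inequality absorbs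
half of that maximum. It serves for comparing two curves, for the first variation and for all error terms.\<close>

lemma stability_unit_interval:
  fixes e :: "real \<Rightarrow> 'a::real_normed_vector"
  assumes der: "\<And>t. t \<in> {0..1} \<Longrightarrow> (e has_vector_derivative e' t) (at t within {0..1})"
    and bd: "\<And>t. t \<in> {0..1} \<Longrightarrow> norm (e' t) \<le> norm (e t) / 2 + b"
    and t: "t \<in> {0..1}"
  shows "norm (e t) \<le> 2 * (norm (e 0) + b)"
proof -
  have "continuous_on {0..1} e"
    using der by (rule continuous_on_vector_derivative)
  then obtain m where m: "m \<in> {0..1}" "\<And>t. t \<in> {0..1} \<Longrightarrow> norm (e t) \<le> norm (e m)"
    using continuous_attains_sup[of "{0..1::real}" "\<lambda>t. norm (e t)"] continuous_on_norm
    by (metis atLeastAtMost_iff compact_Icc empty_iff order_refl zero_le_one)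
  have nn: "0 \<le> norm (e m) / 2 + b"
    using bd[OF m(1)] norm_ge_zero order_trans by blast
  have "norm (e m - e 0) \<le> (norm (e m) / 2 + b) * norm (m - 0)"
  proof (rule differentiable_bound[of "{0..1}" e "\<lambda>t s. s *\<^sub>R e' t"])
    fix t :: real assume t: "t \<in> {0..1}"
    show "(e has_derivative (\<lambda>s. s *\<^sub>R e' t)) (at t within {0..1})"
      using der[OF t] by (simp add: has_vector_derivative_def)
    show "onorm (\<lambda>s. s *\<^sub>R e' t) \<le> norm (e m) / 2 + b"
    proof (rule onorm_le)
      fix s :: real
      have "norm (e' t) \<le> norm (e m) / 2 + b" using bd[OF t] m(2)[OF t] by linarith
      then show "norm (s *\<^sub>R e' t) \<le> (norm (e m) / 2 + b) * norm s"
        by (simp add: mult.commute mult_left_mono)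
    qed
  qed (use m in auto)
  also have "\<dots> \<le> norm (e m) / 2 + b"
    using m(1) nn by (auto intro: mult_right_le_one_le)
  finally have "norm (e m - e 0) \<le> norm (e m) / 2 + b" .
  with norm_triangle_sub[of "e m" "e 0"] have "norm (e m) \<le> 2 * (norm (e 0) + b)"
    by argo
  then show ?thesis using m(2)[OF t] by linarith
qed

lemma has_vector_derivative_reverse:
  assumes "(c has_vector_derivative D) (at (1 - t) within {0..1})"
  shows "((\<lambda>t. c (1 - t)) has_vector_derivative - D) (at t within {0..1::real})"
proof -
  have "(\<lambda>t. 1 - t) ` {0..1} = {0..1::real}" by (auto simp: image_iff intro: bexI[of _ "1 - _"])
  moreover have "((\<lambda>t. 1 - t) has_vector_derivative - 1) (at t within {0..1})"
    by (auto intro!: derivative_eq_intros)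
  ultimately show ?thesis
    using vector_diff_chain_within[of "\<lambda>t. 1 - t" "-1" t "{0..1}" c D] assms by (simp add: comp_def)
qed

section \<open>Local flows and their dependence on the initial point\<close>

definition integral_curve :: "'a set \<Rightarrow> ('a \<Rightarrow> 'a) \<Rightarrow> (real \<Rightarrow> 'a::real_normed_vector) \<Rightarrow> bool"
  where "integral_curve \<Omega> Y c \<longleftrightarrow>
    (\<forall>t\<in>{0..1}. c t \<in> \<Omega> \<and> (c has_vector_derivative Y (c t)) (at t within {0..1}))"

definition C1_field :: "'a set \<Rightarrow> ('a \<Rightarrow> 'a) \<Rightarrow> ('a \<Rightarrow> 'a::real_normed_vector \<Rightarrow>\<^sub>L 'a) \<Rightarrow> bool"
  where "C1_field \<Omega> Y Y' \<longleftrightarrow>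
    (\<forall>z\<in>\<Omega>. (Y has_derivative blinfun_apply (Y' z)) (at z)) \<and> continuous_on \<Omega> Y'"

text \<open>The map \<open>\<Phi> s\<close> is the flow of \<open>Y\<close> for time \<open>s\<close>, that is, of \<open>s Y\<close> for time one, and \<open>\<Lambda> s z\<close> is its derivative in the initial
point. The last two conclusions are the first-order expansions in \<open>s\<close> of \<open>\<Phi>\<close> and of \<open>\<Lambda>\<close>;
the latter is what turns the pullback of a field into a Lie bracket.\<close>

lemma local_flow:
  fixes Y :: "'a::euclidean_space \<Rightarrow> 'a"
  assumes "open \<Omega>" and C1: "C1_field \<Omega> Y Y'" and q: "q \<in> \<Omega>"
  obtains r \<Phi> \<Lambda> where "r > 0" "ball q r \<subseteq> \<Omega>"
    "\<And>s z. \<lbrakk>\<bar>s\<bar> < r; z \<in> ball q r\<rbrakk> \<Longrightarrow>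
       \<exists>c. integral_curve \<Omega> (\<lambda>z. s *\<^sub>R Y z) c \<and> c 0 = z \<and> c 1 = \<Phi> s z"
    "continuous_on ({-r<..<r} \<times> ball q r) (\<lambda>(s, z). \<Phi> s z)"
    "\<And>s z. \<lbrakk>\<bar>s\<bar> < r; z \<in> ball q r; \<Phi> s z \<in> ball q r\<rbrakk> \<Longrightarrow> \<Phi> (-s) (\<Phi> s z) = z"
    "\<And>s z. \<lbrakk>\<bar>s\<bar> < r; z \<in> ball q r\<rbrakk> \<Longrightarrow> (\<Phi> s has_derivative blinfun_apply (\<Lambda> s z)) (at z)"
    "((\<lambda>(s, z). \<Phi> s z) has_derivative (\<lambda>(p, h). h + p *\<^sub>R Y q)) (at (0, q))"
    "\<And>e. e > 0 \<Longrightarrow> \<exists>\<delta>>0. \<forall>s z. \<bar>s\<bar> < \<delta> \<longrightarrow> z \<in> ball q \<delta> \<longrightarrow>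
       norm (\<Lambda> s z - id_blinfun - s *\<^sub>R Y' q) \<le> e * \<bar>s\<bar>"
proof -
  obtain \<rho> where \<rho>: "\<rho> > 0" "cball q (2 * \<rho>) \<subseteq> \<Omega>"
  proof -
    obtain e where "e > 0" "cball q e \<subseteq> \<Omega>"
      using \<open>open \<Omega>\<close> q open_contains_cball by blast
    then show thesis by (intro that[of "e/2"]) auto
  qed
  define K where "K = cball q (2 * \<rho>)"
  have K: "compact K" "convex K" "closed K" "K \<noteq> {}" "K \<subseteq> \<Omega>"
    using \<rho> by (auto simp: K_def)
  have dY: "(Y has_derivative blinfun_apply (Y' z)) (at z)" if "z \<in> \<Omega>" for z
    using C1 that by (auto simp: C1_field_def)
  have contY': "continuous_on K Y'"
    using C1 K(5) continuous_on_subset by (auto simp: C1_field_def)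
  have contY: "continuous_on K Y"
    using dY K(5) by (meson has_derivative_at_withinI has_derivative_continuous_on subset_iff)
  have "bounded (Y ` K)" "bounded (Y' ` K)"
    using K(1) contY contY' by (auto intro!: compact_imp_bounded compact_continuous_image)
  then obtain M1 M2 where "\<And>z. z \<in> K \<Longrightarrow> norm (Y z) \<le> M1" "\<And>z. z \<in> K \<Longrightarrow> norm (Y' z) \<le> M2"
    by (auto simp: bounded_iff)
  then obtain M where M: "M > 0" "\<And>z. z \<in> K \<Longrightarrow> norm (Y z) \<le> M" "\<And>z. z \<in> K \<Longrightarrow> norm (Y' z) \<le> M"
    by (intro that[of "max 1 (max M1 M2)"]) (auto simp: max.coboundedI2 le_max_iff_disj)
  have M0: "0 \<le> M" using M(1) by simp
  have lipY: "norm (Y y - Y z) \<le> M * norm (y - z)" if "y \<in> K" "z \<in> K" for y z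
    by (rule differentiable_bound[OF K(2) _ _ that, of _ "\<lambda>z. blinfun_apply (Y' z)"])
      (use dY K(5) M(3) in \<open>auto intro: has_derivative_at_withinI simp: norm_blinfun.rep_eq[symmetric]\<close>)
  \<comment> \<open>Composing with the nearest-point projection onto \<open>K\<close> makes the field globally Lipschitz
    without changing it on \<open>K\<close>, where the solutions turn out to stay.\<close>
  define pr where "pr = closest_point K"
  have pr: "pr z \<in> K" for z unfolding pr_def using K by (simp add: closest_point_in_set)
  have pr_id: "pr z = z" if "z \<in> K" for z unfolding pr_def using that by (simp add: closest_point_self)
  have pr_lip: "norm (pr y - pr z) \<le> norm (y - z)" for y z
    unfolding pr_def using closest_point_lipschitz[OF K(2,3,4), of y z] by (simp add: dist_norm)
  have contpr: "continuous_on UNIV pr" unfolding pr_def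
    using continuous_on_closest_point[OF K(2,3,4)] by simp
  \<comment> \<open>The three bounds keep the initial points in the ball of radius \<open>\<rho>\<close>, the curves within \<open>\<rho>\<close>
    of their initial points, and the Lipschitz constant of \<open>s Y\<close> below a half.\<close>
  define r where "r = min \<rho> (min (\<rho> / (2 * M)) (1 / (2 * M)))"
  have r: "r > 0" "r \<le> \<rho>"
    unfolding r_def using \<rho>(1) M(1) by auto
  have "r \<le> \<rho> / (2 * M)" "r \<le> 1 / (2 * M)" unfolding r_def by auto
  then have rM: "r * M \<le> \<rho> / 2" "r * M \<le> 1/2" using M(1) by (simp_all add: field_simps)
  have ex: "\<exists>c. c 0 = z \<and> (\<forall>t\<in>{0..1}. c t \<in> K \<and> (c has_vector_derivative s *\<^sub>R Y (c t)) (at t within {0..1}))"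
    if s: "\<bar>s\<bar> < r" and z: "z \<in> ball q r" for s z
  proof -
    have sM: "\<bar>s\<bar> * M \<le> 1/2" "\<bar>s\<bar> * M \<le> \<rho>/2"
      using s rM M(1) by (smt (verit) mult_less_cancel_right)+
    obtain c where c: "c 0 = z"
      "\<And>t. t \<in> {0..1} \<Longrightarrow> (c has_vector_derivative s *\<^sub>R Y (pr (c t))) (at t within {0..1})"
    proof (rule picard_unit_interval[of "\<lambda>t z. s *\<^sub>R Y (pr z)" z])
      show "continuous_on ({0..1} \<times> UNIV) (\<lambda>(t, z). s *\<^sub>R Y (pr z))"
        unfolding case_prod_beta
        by (intro continuous_intros continuous_on_compose2[OF contY]
            continuous_on_compose2[OF contpr]) (use pr in auto)
      show "norm (s *\<^sub>R Y (pr y) - s *\<^sub>R Y (pr z)) \<le> norm (y - z) / 2" for y z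
      proof -
        have "norm (s *\<^sub>R Y (pr y) - s *\<^sub>R Y (pr z)) = \<bar>s\<bar> * norm (Y (pr y) - Y (pr z))"
          by (simp flip: scaleR_diff_right)
        also have "\<dots> \<le> \<bar>s\<bar> * (M * norm (y - z))"
          by (intro mult_left_mono order_trans[OF lipY[OF pr pr]] pr_lip M0) auto
        also have "\<dots> \<le> 1/2 * norm (y - z)"
          unfolding mult.assoc[symmetric] by (intro mult_right_mono sM) auto
        finally show ?thesis by simp
      qed
    qed blast
    have "norm (c t - z) \<le> \<rho>" if t: "t \<in> {0..1}" for t
    proof -
      have "norm (c t - z) \<le> 2 * (norm (c 0 - z) + \<bar>s\<bar> * M)"
      proof (rule stability_unit_interval[OF _ _ t])
        fix t :: real assume t: "t \<in> {0..1}"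
        show "((\<lambda>t. c t - z) has_vector_derivative s *\<^sub>R Y (pr (c t))) (at t within {0..1})"
          using has_vector_derivative_diff[OF c(2)[OF t] has_vector_derivative_const] by simp
        have "norm (s *\<^sub>R Y (pr (c t))) \<le> \<bar>s\<bar> * M"
          using M(2)[OF pr] by (simp add: mult_left_mono)
        then show "norm (s *\<^sub>R Y (pr (c t))) \<le> norm (c t - z) / 2 + \<bar>s\<bar> * M"
          by (simp add: add_increasing)
      qed
      then show ?thesis using c(1) sM by simp
    qed
    then have "c t \<in> K" if "t \<in> {0..1}" for t
      using that z r(2) norm_triangle_ineq4[of "c t - z" "q - z"]
      by (fastforce simp: K_def dist_norm norm_minus_commute algebra_simps)
    then show ?thesis using c pr_id by (intro exI[of _ c]) auto
  qed
  define c where "c s z = (SOME c. c 0 = z \<and> (\<forall>t\<in>{0..1}. c t \<in> K \<and>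
    (c has_vector_derivative s *\<^sub>R Y (c t)) (at t within {0..1})))" for s z
  have c: "c s z 0 = z" "t \<in> {0..1} \<Longrightarrow> c s z t \<in> K"
    "t \<in> {0..1} \<Longrightarrow> (c s z has_vector_derivative s *\<^sub>R Y (c s z t)) (at t within {0..1})"
    if "\<bar>s\<bar> < r" "z \<in> ball q r" for s z t
    using someI_ex[OF ex[OF that]] unfolding c_def by blast+
  have sM: "\<bar>s\<bar> * M \<le> 1/2" if "\<bar>s\<bar> < r" for s
    using that rM M(1) by (smt (verit) mult_less_cancel_right)
  have compare: "norm (b t - b' t) \<le> 2 * (norm (b 0 - b' 0) + \<bar>s - s'\<bar> * M)"
    if s: "\<bar>s\<bar> < r" "\<bar>s'\<bar> < r" and t: "t \<in> {0..1}"
      and b: "\<And>t. t \<in> {0..1} \<Longrightarrow> b t \<in> K \<and> (b has_vector_derivative s *\<^sub>R Y (b t)) (at t within {0..1})"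
      and b': "\<And>t. t \<in> {0..1} \<Longrightarrow> b' t \<in> K \<and> (b' has_vector_derivative s' *\<^sub>R Y (b' t)) (at t within {0..1})"
    for s s' b b' and t :: real
  proof (rule stability_unit_interval[OF _ _ t])
    fix t :: real assume t: "t \<in> {0..1}"
    show "((\<lambda>t. b t - b' t) has_vector_derivative s *\<^sub>R Y (b t) - s' *\<^sub>R Y (b' t)) (at t within {0..1})"
      using has_vector_derivative_diff b[OF t] b'[OF t] by blast
    have "s *\<^sub>R Y (b t) - s' *\<^sub>R Y (b' t) = s *\<^sub>R (Y (b t) - Y (b' t)) + (s - s') *\<^sub>R Y (b' t)"
      by (simp add: algebra_simps)
    also have "norm \<dots> \<le> \<bar>s\<bar> * norm (Y (b t) - Y (b' t)) + \<bar>s - s'\<bar> * norm (Y (b' t))"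
      by (metis norm_triangle_ineq norm_scaleR)
    also have "\<dots> \<le> \<bar>s\<bar> * (M * norm (b t - b' t)) + \<bar>s - s'\<bar> * M"
      using b[OF t] b'[OF t] by (intro add_mono mult_left_mono lipY M(2)) auto
    also have "\<dots> \<le> 1/2 * norm (b t - b' t) + \<bar>s - s'\<bar> * M"
      unfolding mult.assoc[symmetric] by (intro add_right_mono mult_right_mono sM s) auto
    finally show "norm (s *\<^sub>R Y (b t) - s' *\<^sub>R Y (b' t)) \<le> norm (b t - b' t) / 2 + \<bar>s - s'\<bar> * M"
      by simp
  qed
  define \<Phi> where "\<Phi> s z = c s z 1" for s z
  have lip\<Phi>: "norm (c s z t - c s' z' t) \<le> 2 * (norm (z - z') + \<bar>s - s'\<bar> * M)"
    if "\<bar>s\<bar> < r" "z \<in> ball q r" "\<bar>s'\<bar> < r" "z' \<in> ball q r" "t \<in> {0..1}" for s z s' z' t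
    using compare[of s s' t "c s z" "c s' z'"] c that by auto
  have inv: "\<Phi> (-s) (\<Phi> s z) = z" if s: "\<bar>s\<bar> < r" and z: "z \<in> ball q r" and w: "\<Phi> s z \<in> ball q r" for s z
  proof -
    define b where "b = (\<lambda>t. c s z (1 - t))"
    have "(b has_vector_derivative (-s) *\<^sub>R Y (b t)) (at t within {0..1})" if "t \<in> {0..1}" for t
      using has_vector_derivative_reverse[OF c(3)[OF s z, of "1 - t"]] that by (simp add: b_def)
    moreover have "b t \<in> K" if "t \<in> {0..1}" for t using c(2)[OF s z, of "1 - t"] that by (simp add: b_def)
    ultimately have "norm (c (-s) (\<Phi> s z) 1 - b 1) \<le> 2 * (norm (c (-s) (\<Phi> s z) 0 - b 0) + \<bar>-s - -s\<bar> * M)"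
      using c(2,3)[of "-s" "\<Phi> s z"] w s by (intro compare) auto
    then show ?thesis using c(1)[OF s z] c(1)[of "-s" "\<Phi> s z"] s w by (simp add: b_def \<Phi>_def)
  qed
  have cont\<Phi>: "continuous_on ({-r<..<r} \<times> ball q r) (\<lambda>(s, z). \<Phi> s z)"
  proof (rule lipschitz_on_continuous_on[OF lipschitz_onI])
    fix x y assume "x \<in> {-r<..<r} \<times> ball q r" "y \<in> {-r<..<r} \<times> ball q r"
    then have "norm (c (fst x) (snd x) 1 - c (fst y) (snd y) 1)
        \<le> 2 * (norm (snd x - snd y) + \<bar>fst x - fst y\<bar> * M)"
      by (intro lip\<Phi>) auto
    also have "\<dots> \<le> 2 * (dist x y + dist x y * M)"
      using dist_fst_le[of x y] dist_snd_le[of x y] M(1)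
      by (intro mult_left_mono add_mono mult_right_mono) (auto simp: dist_norm)
    finally show "dist (case x of (s, z) \<Rightarrow> \<Phi> s z) (case y of (s, z) \<Rightarrow> \<Phi> s z) \<le> (2 + 2 * M) * dist x y"
      by (simp add: \<Phi>_def dist_norm case_prod_beta algebra_simps)
  qed (use M(1) in auto)
  have ballK: "ball q r \<subseteq> K" using r(2) \<rho>(1) by (auto simp: K_def)
  have qb: "q \<in> ball q r" using r by simp
  have small: "norm (c s z t - z) \<le> 2 * (\<bar>s\<bar> * M)" if "\<bar>s\<bar> < r" "z \<in> ball q r" "t \<in> {0..1}" for s z t
    using compare[of s 0 t "c s z" "\<lambda>_. z"] c that ballK r(1) by (auto simp: subset_iff)
  \<comment> \<open>The derivative of the flow solves the first variation equation, a linear equation along the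
    curve \<open>c s z\<close> for operators.\<close>
  have ex\<Lambda>: "\<exists>L. L 0 = id_blinfun \<and> (\<forall>t\<in>{0..1}.
      (L has_vector_derivative s *\<^sub>R (Y' (c s z t) o\<^sub>L L t)) (at t within {0..1}))"
    if s: "\<bar>s\<bar> < r" and z: "z \<in> ball q r" for s z
  proof -
    have contc: "continuous_on {0..1} (c s z)"
      using c(3)[OF s z] by (rule continuous_on_vector_derivative)
    obtain L where "L 0 = id_blinfun" "\<And>t. t \<in> {0..1} \<Longrightarrow>
        (L has_vector_derivative s *\<^sub>R (Y' (c s z t) o\<^sub>L L t)) (at t within {0..1})"
    proof (rule picard_unit_interval[of "\<lambda>t L. s *\<^sub>R (Y' (c s z t) o\<^sub>L L)" id_blinfun])
      show "continuous_on ({0..1} \<times> UNIV) (\<lambda>(t, L). s *\<^sub>R (Y' (c s z t) o\<^sub>L L))"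
        unfolding case_prod_beta
        by (intro continuous_intros bounded_bilinear.continuous_on[OF bounded_bilinear_blinfun_compose]
            continuous_on_compose2[OF contY'] continuous_on_compose2[OF contc])
          (use c(2)[OF s z] in auto)
      fix t :: real and L L' :: "'a \<Rightarrow>\<^sub>L 'a" assume t: "t \<in> {0..1}"
      have "norm (s *\<^sub>R (Y' (c s z t) o\<^sub>L L) - s *\<^sub>R (Y' (c s z t) o\<^sub>L L')) = \<bar>s\<bar> * norm (Y' (c s z t) o\<^sub>L (L - L'))"
        by (simp add: bounded_bilinear.diff_right[OF bounded_bilinear_blinfun_compose] flip: scaleR_diff_right)
      also have "\<dots> \<le> \<bar>s\<bar> * (M * norm (L - L'))"
        by (intro mult_left_mono order_trans[OF norm_blinfun_compose] mult_right_mono M c s z t) auto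
      also have "\<dots> \<le> 1/2 * norm (L - L')"
        unfolding mult.assoc[symmetric] by (intro mult_right_mono sM s) auto
      finally show "norm (s *\<^sub>R (Y' (c s z t) o\<^sub>L L) - s *\<^sub>R (Y' (c s z t) o\<^sub>L L')) \<le> norm (L - L') / 2"
        by simp
    qed blast
    then show ?thesis by blast
  qed
  define L where "L s z = (SOME L. L 0 = id_blinfun \<and> (\<forall>t\<in>{0..1}.
      (L has_vector_derivative s *\<^sub>R (Y' (c s z t) o\<^sub>L L t)) (at t within {0..1})))" for s z
  have L: "L s z 0 = id_blinfun" "t \<in> {0..1} \<Longrightarrow>
      (L s z has_vector_derivative s *\<^sub>R (Y' (c s z t) o\<^sub>L L s z t)) (at t within {0..1})"
    if "\<bar>s\<bar> < r" "z \<in> ball q r" for s z t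
    using someI_ex[OF ex\<Lambda>[OF that]] unfolding L_def by blast+
  have id1: "norm (id_blinfun :: 'a \<Rightarrow>\<^sub>L 'a) \<le> 1"
    by (simp add: norm_blinfun_id_le)
  have L_bound: "norm (s *\<^sub>R (Y' (c s z t) o\<^sub>L L s z t)) \<le> \<bar>s\<bar> * M * norm (L s z t)"
    if s: "\<bar>s\<bar> < r" and z: "z \<in> ball q r" and t: "t \<in> {0..1}" for s z t
  proof -
    have "norm (Y' (c s z t) o\<^sub>L L s z t) \<le> M * norm (L s z t)"
      by (intro order_trans[OF norm_blinfun_compose] mult_right_mono M c s z t) auto
    then show ?thesis by (simp add: mult.assoc mult_left_mono)
  qed
  have L2: "norm (L s z t) \<le> 2" if s: "\<bar>s\<bar> < r" and z: "z \<in> ball q r" and t: "t \<in> {0..1}" for s z t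
  proof -
    have "norm (L s z t) \<le> 2 * (norm (L s z 0) + 0)"
    proof (rule stability_unit_interval[OF L(2)[OF s z] _ t])
      fix t :: real assume t: "t \<in> {0..1}"
      have "\<bar>s\<bar> * M * norm (L s z t) \<le> 1/2 * norm (L s z t)"
        by (intro mult_right_mono sM s) auto
      then show "norm (s *\<^sub>R (Y' (c s z t) o\<^sub>L L s z t)) \<le> norm (L s z t) / 2 + 0"
        using L_bound[OF s z t] by linarith
    qed
    then show ?thesis using L(1)[OF s z] id1 by simp
  qed
  have L_id: "norm (L s z t - id_blinfun) \<le> 4 * (\<bar>s\<bar> * M)"
    if s: "\<bar>s\<bar> < r" and z: "z \<in> ball q r" and t: "t \<in> {0..1}" for s z t
  proof -
    have "norm (L s z t - id_blinfun) \<le> 2 * (norm (L s z 0 - id_blinfun) + 2 * (\<bar>s\<bar> * M))"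
    proof (rule stability_unit_interval[OF _ _ t])
      fix t :: real assume t: "t \<in> {0..1}"
      show "((\<lambda>t. L s z t - id_blinfun) has_vector_derivative s *\<^sub>R (Y' (c s z t) o\<^sub>L L s z t)) (at t within {0..1})"
        using has_vector_derivative_diff[OF L(2)[OF s z t] has_vector_derivative_const] by simp
      have "\<bar>s\<bar> * M * norm (L s z t) \<le> \<bar>s\<bar> * M * 2"
        using M(1) by (intro mult_left_mono L2 s z t) auto
      then show "norm (s *\<^sub>R (Y' (c s z t) o\<^sub>L L s z t)) \<le> norm (L s z t - id_blinfun) / 2 + 2 * (\<bar>s\<bar> * M)"
        using L_bound[OF s z t] norm_ge_zero[of "L s z t - id_blinfun"] by linarith
    qed
    then show ?thesis using L(1)[OF s z] by simp
  qed
  have unif: "\<exists>\<delta>>0. \<forall>y\<in>K. \<forall>z\<in>K. norm (y - z) < \<delta> \<longrightarrow> norm (Y' y - Y' z) \<le> \<omega>" if "\<omega> > 0" for \<omega>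
    using compact_uniformly_continuous[OF contY' K(1)] that unfolding uniformly_continuous_on_def dist_norm
    by (meson less_imp_le)
  have d\<Phi>: "(\<Phi> s has_derivative blinfun_apply (L s z 1)) (at z)"
    if s: "\<bar>s\<bar> < r" and z: "z \<in> ball q r" for s z
    unfolding has_derivative_at_alt
  proof (intro conjI allI impI)
    fix e :: real assume "e > 0"
    then have \<omega>: "e / (4 * r) > 0" using r by simp
    from unif[OF this] obtain \<delta> where \<delta>: "\<delta> > 0"
      "\<And>y z. \<lbrakk>y \<in> K; z \<in> K; norm (y - z) < \<delta>\<rbrakk> \<Longrightarrow> norm (Y' y - Y' z) \<le> e / (4 * r)" by blast
    obtain \<eta> where \<eta>: "\<eta> > 0" "ball z \<eta> \<subseteq> ball q r"
      using z by (meson open_ball open_contains_ball)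
    show "\<exists>d>0. \<forall>y. norm (y - z) < d \<longrightarrow>
        norm (\<Phi> s y - \<Phi> s z - L s z 1 (y - z)) \<le> e * norm (y - z)"
    proof (intro exI[of _ "min \<eta> (\<delta> / 2)"] conjI allI impI)
      fix y assume y: "norm (y - z) < min \<eta> (\<delta> / 2)"
      then have "y \<in> ball z \<eta>" by (simp add: dist_norm norm_minus_commute)
      then have yb: "y \<in> ball q r" using \<eta>(2) by blast
      define h where "h = y - z"
      define E where "E t = c s y t - c s z t - L s z t h" for t
      have "norm (E 1) \<le> 2 * (norm (E 0) + r * (e / (4 * r) * (2 * norm h)))"
      proof (rule stability_unit_interval)
        fix t :: real assume t: "t \<in> {0..1}"
        let ?a = "c s z t" let ?b = "c s y t"
        show "(E has_vector_derivative s *\<^sub>R Y ?b - s *\<^sub>R Y ?a - s *\<^sub>R Y' ?a (L s z t h)) (at t within {0..1})"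
        proof -
          have "((\<lambda>t. L s z t h) has_vector_derivative (s *\<^sub>R (Y' ?a o\<^sub>L L s z t)) h) (at t within {0..1})"
            by (rule bounded_linear.has_vector_derivative[OF blinfun.bounded_linear_left L(2)[OF s z t]])
          then have "((\<lambda>t. L s z t h) has_vector_derivative s *\<^sub>R Y' ?a (L s z t h)) (at t within {0..1})"
            by (simp add: scaleR_blinfun.rep_eq)
          then show ?thesis
            unfolding E_def by (intro has_vector_derivative_diff c(3) s z yb t)
        qed
        have ab: "norm (?b - ?a) \<le> 2 * norm h"
          using lip\<Phi>[OF s yb s z t] by (simp add: h_def)
        have "norm (Y ?b - Y ?a - Y' ?a (?b - ?a)) \<le> norm (?b - ?a) * (e / (4 * r))"
        proof (rule differentiable_bound_linearization[of ?a ?b "closed_segment ?a ?b" Y "\<lambda>z. blinfun_apply (Y' z)"])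
          have seg: "closed_segment ?a ?b \<subseteq> K"
            using K(2) c(2)[OF s z t] c(2)[OF s yb t] closed_segment_subset by blast
          show "?a + u *\<^sub>R (?b - ?a) \<in> closed_segment ?a ?b" if "u \<in> {0..1}" for u
            using that by (auto simp: in_segment algebra_simps intro!: exI[of _ u])
          fix x assume x: "x \<in> closed_segment ?a ?b"
          show "(Y has_derivative blinfun_apply (Y' x)) (at x within closed_segment ?a ?b)"
            using dY x seg K(5) by (blast intro: has_derivative_at_withinI)
          have "norm (x - ?a) \<le> norm (?b - ?a)"
            using segment_bound1[OF x] by (simp add: norm_minus_commute)
          then have "norm (Y' x - Y' ?a) \<le> e / (4 * r)"
            using \<delta>(2)[of x ?a] x seg ab y c(2)[OF s z t] by (auto simp: h_def)
          then show "onorm (blinfun_apply (Y' x) - blinfun_apply (Y' ?a)) \<le> e / (4 * r)"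
            by (simp add: norm_blinfun.rep_eq minus_blinfun.rep_eq fun_diff_def)
        qed auto
        also have "\<dots> \<le> e / (4 * r) * (2 * norm h)"
          using mult_right_mono[OF ab less_imp_le[OF \<omega>]] by (simp only: mult.commute)
        finally have lin: "norm (Y ?b - Y ?a - Y' ?a (?b - ?a)) \<le> e / (4 * r) * (2 * norm h)" .
        have "s *\<^sub>R Y ?b - s *\<^sub>R Y ?a - s *\<^sub>R Y' ?a (L s z t h)
            = s *\<^sub>R Y' ?a (E t) + s *\<^sub>R (Y ?b - Y ?a - Y' ?a (?b - ?a))"
          by (simp add: E_def blinfun.bilinear_simps algebra_simps)
        also have "norm \<dots> \<le> \<bar>s\<bar> * norm (Y' ?a (E t)) + \<bar>s\<bar> * norm (Y ?b - Y ?a - Y' ?a (?b - ?a))"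
          by (metis norm_triangle_ineq norm_scaleR)
        also have "\<dots> \<le> \<bar>s\<bar> * (M * norm (E t)) + r * (e / (4 * r) * (2 * norm h))"
          using s lin \<omega> by (intro add_mono mult_left_mono mult_mono order_trans[OF norm_blinfun] mult_right_mono M c z t) auto
        also have "\<dots> \<le> 1/2 * norm (E t) + r * (e / (4 * r) * (2 * norm h))"
          unfolding mult.assoc[symmetric, of "\<bar>s\<bar>"] by (intro add_right_mono mult_right_mono sM s) auto
        finally show "norm (s *\<^sub>R Y ?b - s *\<^sub>R Y ?a - s *\<^sub>R Y' ?a (L s z t h))
            \<le> norm (E t) / 2 + r * (e / (4 * r) * (2 * norm h))" by simp
      qed auto
      also have "E 0 = 0" using c(1)[OF s z] c(1)[OF s yb] L(1)[OF s z] by (simp add: E_def h_def)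
      finally show "norm (\<Phi> s y - \<Phi> s z - L s z 1 (y - z)) \<le> e * norm (y - z)"
        using r by (simp add: E_def \<Phi>_def h_def)
    qed (use \<eta> \<delta> in auto)
  qed (rule blinfun.bounded_linear_right)
  have joint: "((\<lambda>(s, z). \<Phi> s z) has_derivative (\<lambda>(p, h). h + p *\<^sub>R Y q)) (at (0, q))"
    unfolding has_derivative_at_alt
  proof (intro conjI allI impI)
    show "bounded_linear (\<lambda>(p, h). h + p *\<^sub>R Y q)"
      unfolding case_prod_beta by (intro bounded_linear_intros)
    fix e :: real assume e: "e > 0"
    define A where "A = 2 * M * (2 * M + 1)"
    have A: "A > 0" using M(1) by (simp add: A_def)
    have \<Phi>0: "\<Phi> 0 q = q" using small[of 0 q 1] r(1) by (simp add: \<Phi>_def)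
    show "\<exists>d>0. \<forall>y. norm (y - (0, q)) < d \<longrightarrow>
        norm ((case y of (s, z) \<Rightarrow> \<Phi> s z) - (case (0, q) of (s, z) \<Rightarrow> \<Phi> s z) - (case y - (0, q) of (p, h) \<Rightarrow> h + p *\<^sub>R Y q))
        \<le> e * norm (y - (0, q))"
    proof (intro exI[of _ "min r (e / A)"] conjI allI impI)
      fix y :: "real \<times> 'a" assume y: "norm (y - (0, q)) < min r (e / A)"
      obtain s z where [simp]: "y = (s, z)" by (cases y)
      define n where "n = norm (y - (0, q))"
      have n: "\<bar>s\<bar> \<le> n" "norm (z - q) \<le> n" "n < r" "n * A \<le> e"
        using norm_fst_le[of s "z - q"] norm_snd_le[of "z - q" s] y A
        by (auto simp: n_def field_simps)
      have s: "\<bar>s\<bar> < r" and z: "z \<in> ball q r" using n by (auto simp: dist_norm norm_minus_commute)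
      define E where "E t = c s z t - z - t *\<^sub>R (s *\<^sub>R Y q)" for t
      have "norm (E 1) \<le> 2 * (norm (E 0) + n * (M * (2 * (n * M) + n)))"
      proof (rule stability_unit_interval)
        fix t :: real assume t: "t \<in> {0..1}"
        show "(E has_vector_derivative s *\<^sub>R Y (c s z t) - s *\<^sub>R Y q) (at t within {0..1})"
          unfolding E_def using c(3)[OF s z t] by (auto intro!: derivative_eq_intros)
        have "norm (c s z t - q) \<le> norm (c s z t - z) + norm (z - q)"
          by (metis norm_triangle_sub add.commute diff_add_cancel add_diff_eq norm_triangle_ineq)
        also have "\<dots> \<le> 2 * (\<bar>s\<bar> * M) + norm (z - q)" using small[OF s z t] by simp
        also have "\<dots> \<le> 2 * (n * M) + n" using n M(1) by (intro add_mono mult_left_mono mult_right_mono) auto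
        finally have "norm (Y (c s z t) - Y q) \<le> M * (2 * (n * M) + n)"
          using lipY[OF c(2)[OF s z t], of q] ballK qb M(1)
          by (meson mult_left_mono order_trans less_imp_le subsetD)
        then have "\<bar>s\<bar> * norm (Y (c s z t) - Y q) \<le> n * (M * (2 * (n * M) + n))"
          using n(1) by (intro mult_mono) auto
        then show "norm (s *\<^sub>R Y (c s z t) - s *\<^sub>R Y q) \<le> norm (E t) / 2 + n * (M * (2 * (n * M) + n))"
          by (simp add: add_increasing flip: scaleR_diff_right)
      qed auto
      also have "norm (E 0) = 0" using c(1)[OF s z] by (simp add: E_def)
      also have "2 * (0 + n * (M * (2 * (n * M) + n))) = n * A * n" by (simp add: A_def algebra_simps)
      also have "\<dots> \<le> e * n" using n by (intro mult_right_mono) auto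
      finally have "norm (E 1) \<le> e * n" .
      moreover have "E 1 = \<Phi> s z - q - ((z - q) + s *\<^sub>R Y q)"
        by (simp add: E_def \<Phi>_def)
      ultimately show "norm ((case y of (s, z) \<Rightarrow> \<Phi> s z) - (case (0, q) of (s, z) \<Rightarrow> \<Phi> s z) - (case y - (0, q) of (p, h) \<Rightarrow> h + p *\<^sub>R Y q))
        \<le> e * norm (y - (0, q))"
        using \<Phi>0 by (simp add: n_def)
    qed (use r A e in auto)
  qed
  have \<Lambda>est: "\<exists>\<delta>>0. \<forall>s z. \<bar>s\<bar> < \<delta> \<longrightarrow> z \<in> ball q \<delta> \<longrightarrow>
       norm (L s z 1 - id_blinfun - s *\<^sub>R Y' q) \<le> e * \<bar>s\<bar>" if e: "e > 0" for e
  proof -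
    from unif[of "e / 8"] e obtain \<delta> where \<delta>: "\<delta> > 0"
      "\<And>y z. \<lbrakk>y \<in> K; z \<in> K; norm (y - z) < \<delta>\<rbrakk> \<Longrightarrow> norm (Y' y - Y' z) \<le> e / 8" by auto
    define d where "d = min (min r (e / (16 * M * M))) (\<delta> / (2 * M + 1))"
    have d: "d > 0" "d \<le> r" "d * (16 * M * M) \<le> e" "d * (2 * M + 1) \<le> \<delta>"
    proof -
      show "d > 0" "d \<le> r" using r(1) e M(1) \<delta>(1) by (auto simp: d_def)
      have "d \<le> e / (16 * M * M)" "d \<le> \<delta> / (2 * M + 1)" by (auto simp: d_def)
      then show "d * (16 * M * M) \<le> e" "d * (2 * M + 1) \<le> \<delta>" using M(1) by (simp_all add: field_simps)
    qed
    have "norm (L s z 1 - id_blinfun - s *\<^sub>R Y' q) \<le> e * \<bar>s\<bar>" if "\<bar>s\<bar> < d" "z \<in> ball q d" for s z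
    proof -
      have s: "\<bar>s\<bar> < r" and z: "z \<in> ball q r" using that d(2) by auto
      define E where "E t = L s z t - id_blinfun - t *\<^sub>R (s *\<^sub>R Y' q)" for t
      have "norm (E 1) \<le> 2 * (norm (E 0) + \<bar>s\<bar> * (e / 8 * 2 + M * (4 * (\<bar>s\<bar> * M))))"
      proof (rule stability_unit_interval)
        fix t :: real assume t: "t \<in> {0..1}"
        let ?a = "c s z t"
        show "(E has_vector_derivative s *\<^sub>R (Y' ?a o\<^sub>L L s z t) - s *\<^sub>R Y' q) (at t within {0..1})"
          unfolding E_def using L(2)[OF s z t] by (auto intro!: derivative_eq_intros)
        have "norm (?a - q) \<le> norm (?a - z) + norm (z - q)"
          by (metis norm_triangle_ineq add_diff_eq diff_add_cancel)
        also have "\<dots> \<le> 2 * (\<bar>s\<bar> * M) + norm (z - q)" using small[OF s z t] by simp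
        also have "\<dots> < 2 * (d * M) + d"
          using that M(1) by (intro add_le_less_mono mult_left_mono mult_right_mono)
            (auto simp: dist_norm norm_minus_commute)
        also have "\<dots> \<le> \<delta>" using d(4) by (simp add: algebra_simps)
        finally have "norm (Y' ?a - Y' q) \<le> e / 8"
          using \<delta>(2)[OF c(2)[OF s z t]] ballK qb by blast
        then have 1: "norm ((Y' ?a - Y' q) o\<^sub>L L s z t) \<le> e / 8 * 2"
          using e by (intro order_trans[OF norm_blinfun_compose] mult_mono L2 s z t) auto
        have 2: "norm (Y' q o\<^sub>L (L s z t - id_blinfun)) \<le> M * (4 * (\<bar>s\<bar> * M))"
          using M(1) ballK qb by (intro order_trans[OF norm_blinfun_compose] mult_mono L_id s z t M(3)) auto
        have "s *\<^sub>R (Y' ?a o\<^sub>L L s z t) - s *\<^sub>R Y' q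
            = s *\<^sub>R (((Y' ?a - Y' q) o\<^sub>L L s z t) + (Y' q o\<^sub>L (L s z t - id_blinfun)))"
          by (rule blinfun_eqI)
            (simp add: plus_blinfun.rep_eq minus_blinfun.rep_eq scaleR_blinfun.rep_eq blinfun.diff_right
              algebra_simps)
        also have "norm \<dots> \<le> \<bar>s\<bar> * (e / 8 * 2 + M * (4 * (\<bar>s\<bar> * M)))"
          unfolding norm_scaleR
          by (intro mult_left_mono order_trans[OF norm_triangle_ineq] add_mono 1 2) auto
        finally show "norm (s *\<^sub>R (Y' ?a o\<^sub>L L s z t) - s *\<^sub>R Y' q)
            \<le> norm (E t) / 2 + \<bar>s\<bar> * (e / 8 * 2 + M * (4 * (\<bar>s\<bar> * M)))"
          using norm_ge_zero[of "E t"] by linarith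
      qed auto
      also have "norm (E 0) = 0" using L(1)[OF s z] by (simp add: E_def)
      also have "2 * (0 + \<bar>s\<bar> * (e / 8 * 2 + M * (4 * (\<bar>s\<bar> * M)))) = \<bar>s\<bar> * (e / 2 + \<bar>s\<bar> * (16 * M * M) / 2)"
        by (simp add: field_simps)
      also have "\<dots> \<le> \<bar>s\<bar> * (e / 2 + e / 2)"
      proof (intro mult_left_mono add_left_mono)
          have "\<bar>s\<bar> * (16 * M * M) \<le> d * (16 * M * M)"
            using that(1) M(1) by (intro mult_right_mono) auto
          then show "\<bar>s\<bar> * (16 * M * M) / 2 \<le> e / 2" using d(3) by linarith
        qed auto
      finally show ?thesis by (simp add: E_def mult.commute)
    qed
    then show ?thesis using d(1) by blast
  qed
  show thesis
  proof (rule that[OF r(1)])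
    show "ball q r \<subseteq> \<Omega>" using ballK K(5) by blast
    show "\<exists>c. integral_curve \<Omega> (\<lambda>z. s *\<^sub>R Y z) c \<and> c 0 = z \<and> c 1 = \<Phi> s z"
      if "\<bar>s\<bar> < r" "z \<in> ball q r" for s z
      using c[OF that] K(5) unfolding integral_curve_def \<Phi>_def by blast
  qed (fact cont\<Phi> inv d\<Phi> joint \<Lambda>est)+
qed

section \<open>Tangent directions of orbits\<close>

lemma has_vector_derivative_zero_if_small:
  fixes E :: "real \<Rightarrow> 'a::real_normed_vector"
  assumes "\<And>e. e > 0 \<Longrightarrow> \<exists>\<delta>>0. \<forall>s. \<bar>s\<bar> < \<delta> \<longrightarrow> norm (E s) \<le> e * \<bar>s\<bar>"
  shows "(E has_vector_derivative 0) (at 0)"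
proof -
  obtain \<delta> where "\<delta> > 0" "\<forall>s. \<bar>s\<bar> < \<delta> \<longrightarrow> norm (E s) \<le> 1 * \<bar>s\<bar>"
    using assms[of 1] by auto
  from this(2)[rule_format, of 0] this(1) have "E 0 = 0" by simp
  then show ?thesis
    using assms unfolding has_vector_derivative_def has_derivative_at_alt by simp
qed

lemma difference_quotient_tendsto:
  fixes f :: "real \<Rightarrow> 'a::real_normed_vector"
  assumes "(f has_vector_derivative D) (at 0)"
  shows "((\<lambda>s. (f s - f 0) /\<^sub>R s) \<longlongrightarrow> D) (at 0)"
proof -
  have "((\<lambda>s. (f s - f 0 - s *\<^sub>R D) /\<^sub>R norm s) \<longlongrightarrow> 0) (at 0)"
    using assms by (simp add: has_vector_derivative_def has_derivative_def)
  then have "((\<lambda>s. norm ((f s - f 0 - s *\<^sub>R D) /\<^sub>R norm s)) \<longlongrightarrow> 0) (at 0)"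
    by (rule tendsto_norm_zero)
  moreover have "norm ((f s - f 0 - s *\<^sub>R D) /\<^sub>R norm s) = norm ((f s - f 0) /\<^sub>R s - D)" if "s \<noteq> 0" for s
  proof -
    have "(f s - f 0) /\<^sub>R s - D = (f s - f 0 - s *\<^sub>R D) /\<^sub>R s"
      using that by (simp add: scaleR_diff_right)
    then show ?thesis by simp
  qed
  ultimately have "((\<lambda>s. norm ((f s - f 0) /\<^sub>R s - D)) \<longlongrightarrow> 0) (at 0)"
    by (elim Lim_transform_eventually) (auto simp: eventually_at intro: exI[of _ 1])
  then show ?thesis by (simp add: tendsto_norm_zero_iff LIM_zero_iff)
qed

text \<open>Closure of the fields under scaling contains time reversal (factor \<open>-1\<close>) and allows every segment to have duration one.\<close>

locale control_family =
  fixes \<Omega> :: "'a::euclidean_space set" and \<Y> :: "('a \<Rightarrow> 'a) set"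
  assumes open_\<Omega>: "open \<Omega>"
    and scaled: "Y \<in> \<Y> \<Longrightarrow> (\<lambda>z. s *\<^sub>R Y z) \<in> \<Y>"
    and smooth: "Y \<in> \<Y> \<Longrightarrow> \<exists>Y'. C1_field \<Omega> Y Y'"
begin

definition step :: "'a \<Rightarrow> 'a \<Rightarrow> bool"
  where "step z w \<longleftrightarrow> (\<exists>Y\<in>\<Y>. \<exists>c. integral_curve \<Omega> Y c \<and> c 0 = z \<and> c 1 = w)"

abbreviation reach :: "'a \<Rightarrow> 'a \<Rightarrow> bool"
  where "reach \<equiv> step\<^sup>*\<^sup>*"

lemma step_sym: "step z w \<Longrightarrow> step w z"
proof -
  assume "step z w"
  then obtain Y c where Y: "Y \<in> \<Y>" and c: "integral_curve \<Omega> Y c" "c 0 = z" "c 1 = w"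
    by (auto simp: step_def)
  have "integral_curve \<Omega> (\<lambda>z. (-1) *\<^sub>R Y z) (\<lambda>t. c (1 - t))"
    using c(1) unfolding integral_curve_def by (auto intro!: has_vector_derivative_reverse)
  then show "step w z"
    unfolding step_def using scaled[OF Y, of "-1"] c(2,3)
    by (intro bexI[of _ "\<lambda>z. (-1) *\<^sub>R Y z"] exI[of _ "\<lambda>t. c (1 - t)"] conjI) auto
qed

lemma reach_sym: "reach z w \<Longrightarrow> reach w z"
  by (metis step_sym sympI symp_rtranclp sympD)

text \<open>The family is required to act on a whole neighbourhood of \<open>z\<close>, and its derivative is joint in \<open>p\<close> and the point, so that
families can be composed and conjugated by flows. Differentiability is demanded at \<open>(0, z)\<close> only.\<close>

definition tangents :: "'a \<Rightarrow> 'a set"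
  where "tangents z = {W. \<exists>m N. open N \<and> (0, z) \<in> N \<and> continuous_on N m \<and> m (0, z) = z \<and>
    (\<forall>(p, x)\<in>N. reach x (m (p, x))) \<and>
    (m has_derivative (\<lambda>(p :: real, h). h + p *\<^sub>R W)) (at (0, z))}"

lemma family_flow:
  assumes Y: "Y \<in> \<Y>" and C1: "C1_field \<Omega> Y Y'" and q: "q \<in> \<Omega>"
  obtains r \<Phi> \<Lambda> where "r > 0" "ball q r \<subseteq> \<Omega>"
    "\<And>s z. \<lbrakk>\<bar>s\<bar> < r; z \<in> ball q r\<rbrakk> \<Longrightarrow> reach z (\<Phi> s z)"
    "continuous_on ({-r<..<r} \<times> ball q r) (\<lambda>(s, z). \<Phi> s z)"
    "\<And>s z. \<lbrakk>\<bar>s\<bar> < r; z \<in> ball q r; \<Phi> s z \<in> ball q r\<rbrakk> \<Longrightarrow> \<Phi> (-s) (\<Phi> s z) = z"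
    "\<And>s z. \<lbrakk>\<bar>s\<bar> < r; z \<in> ball q r\<rbrakk> \<Longrightarrow> (\<Phi> s has_derivative blinfun_apply (\<Lambda> s z)) (at z)"
    "((\<lambda>(s, z). \<Phi> s z) has_derivative (\<lambda>(p, h). h + p *\<^sub>R Y q)) (at (0, q))"
    "\<And>e. e > 0 \<Longrightarrow> \<exists>\<delta>>0. \<forall>s z. \<bar>s\<bar> < \<delta> \<longrightarrow> z \<in> ball q \<delta> \<longrightarrow>
       norm (\<Lambda> s z - id_blinfun - s *\<^sub>R Y' q) \<le> e * \<bar>s\<bar>"
    "\<Phi> 0 q = q"
    "\<And>s. \<bar>s\<bar> < r \<Longrightarrow> continuous_on (ball q r) (\<Phi> s)"
    "((\<lambda>s. \<Phi> s q) has_vector_derivative Y q) (at 0)"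
proof -
  obtain r \<Phi> \<Lambda> where f: "r > 0" "ball q r \<subseteq> \<Omega>"
    "\<And>s z. \<lbrakk>\<bar>s\<bar> < r; z \<in> ball q r\<rbrakk> \<Longrightarrow>
       \<exists>c. integral_curve \<Omega> (\<lambda>z. s *\<^sub>R Y z) c \<and> c 0 = z \<and> c 1 = \<Phi> s z"
    "continuous_on ({-r<..<r} \<times> ball q r) (\<lambda>(s, z). \<Phi> s z)"
    "\<And>s z. \<lbrakk>\<bar>s\<bar> < r; z \<in> ball q r; \<Phi> s z \<in> ball q r\<rbrakk> \<Longrightarrow> \<Phi> (-s) (\<Phi> s z) = z"
    "\<And>s z. \<lbrakk>\<bar>s\<bar> < r; z \<in> ball q r\<rbrakk> \<Longrightarrow> (\<Phi> s has_derivative blinfun_apply (\<Lambda> s z)) (at z)"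
    "((\<lambda>(s, z). \<Phi> s z) has_derivative (\<lambda>(p, h). h + p *\<^sub>R Y q)) (at (0, q))"
    "\<And>e. e > 0 \<Longrightarrow> \<exists>\<delta>>0. \<forall>s z. \<bar>s\<bar> < \<delta> \<longrightarrow> z \<in> ball q \<delta> \<longrightarrow>
       norm (\<Lambda> s z - id_blinfun - s *\<^sub>R Y' q) \<le> e * \<bar>s\<bar>"
    using local_flow[OF open_\<Omega> C1 q] by blast
  have 1: "reach z (\<Phi> s z)" if "\<bar>s\<bar> < r" "z \<in> ball q r" for s z
    using f(3)[OF that] scaled[OF Y, of s] unfolding step_def by (blast intro: r_into_rtranclp)
  have 2: "\<Phi> 0 q = q"
  proof -
    obtain c where c: "integral_curve \<Omega> (\<lambda>z. 0 *\<^sub>R Y z) c" "c 0 = q" "c 1 = \<Phi> 0 q"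
      using f(3)[of 0 q] f(1) by auto
    have "norm (c 1 - q) \<le> 2 * (norm (c 0 - q) + 0)"
      by (rule stability_unit_interval[where e' = "\<lambda>_. 0"])
        (use c(1) in \<open>auto simp: integral_curve_def intro!: derivative_eq_intros\<close>)
    then show ?thesis using c by simp
  qed
  have 3: "continuous_on (ball q r) (\<Phi> s)" if "\<bar>s\<bar> < r" for s
  proof -
    have "continuous_on (ball q r) (\<lambda>z. (s, z))" by (intro continuous_intros)
    moreover have "(\<lambda>z. (s, z)) ` ball q r \<subseteq> {-r<..<r} \<times> ball q r" using that by auto
    ultimately show ?thesis using continuous_on_compose2[OF f(4)] by fastforce
  qed
  have 4: "((\<lambda>s. \<Phi> s q) has_vector_derivative Y q) (at 0)"
  proof -
    have "((\<lambda>s. (s, q)) has_derivative (\<lambda>s. (s, 0))) (at (0::real))"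
      by (auto intro!: derivative_eq_intros)
    from has_derivative_compose[OF this f(7)] show ?thesis by (simp add: has_vector_derivative_def)
  qed
  show thesis
    by (rule that[OF f(1,2) 1 f(4-8) 2 3 4])
qed

lemma field_in_tangents:
  assumes Y: "Y \<in> \<Y>" and q: "q \<in> \<Omega>"
  shows "Y q \<in> tangents q"
proof -
  obtain Y' where C1: "C1_field \<Omega> Y Y'" using smooth[OF Y] by blast
  obtain r \<Phi> \<Lambda> where f: "r > 0"
    "\<And>s z. \<lbrakk>\<bar>s\<bar> < r; z \<in> ball q r\<rbrakk> \<Longrightarrow> reach z (\<Phi> s z)"
    "continuous_on ({-r<..<r} \<times> ball q r) (\<lambda>(s, z). \<Phi> s z)"
    "((\<lambda>(s, z). \<Phi> s z) has_derivative (\<lambda>(p, h). h + p *\<^sub>R Y q)) (at (0, q))"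
    "\<Phi> 0 q = q"
    by (rule family_flow[OF Y C1 q]) blast
  show ?thesis
    unfolding tangents_def mem_Collect_eq
    by (intro exI[of _ "\<lambda>(s, z). \<Phi> s z"] exI[of _ "{-r<..<r} \<times> ball q r"] conjI f(3,4))
      (use f in \<open>auto intro: open_Times\<close>)
qed

text \<open>The family witnessing \<open>W\<close> at \<open>g z\<close> is conjugated: go to \<open>g x\<close>, displace, return by \<open>g'\<close>. The derivative of \<open>g' \<circ> g = id\<close> gives
\<open>G' (G h) = h\<close>, which leaves \<open>h + p G' W\<close> as the derivative of the conjugated family.\<close>

lemma tangents_pullback:
  assumes U: "open U" "z \<in> U" and U': "open U'" "g z \<in> U'"
    and cont: "continuous_on U g" "continuous_on U' g'"
    and reach: "\<And>x. x \<in> U \<Longrightarrow> reach x (g x)" "\<And>x. x \<in> U' \<Longrightarrow> reach x (g' x)"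
    and der: "(g has_derivative G) (at z)" "(g' has_derivative G') (at (g z))"
    and inv: "\<And>x. \<lbrakk>x \<in> U; g x \<in> U'\<rbrakk> \<Longrightarrow> g' (g x) = x"
    and W: "W \<in> tangents (g z)"
  shows "G' W \<in> tangents z"
proof -
  obtain m N where m: "open N" "(0, g z) \<in> N" "continuous_on N m" "m (0, g z) = g z"
    "\<And>p x. (p, x) \<in> N \<Longrightarrow> reach x (m (p, x))"
    "(m has_derivative (\<lambda>(p :: real, h). h + p *\<^sub>R W)) (at (0, g z))"
    using W unfolding tangents_def by blast
  interpret G': bounded_linear G' using der(2) by (rule has_derivative_bounded_linear)
  have G'G: "G' (G h) = h" for h
  proof -
    have op: "open (U \<inter> g -` U')" using continuous_open_preimage[OF cont(1) U(1) U'(1)] .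
    have "((\<lambda>x. g' (g x)) has_derivative (\<lambda>x. G' (G x))) (at z)"
      by (rule has_derivative_compose[OF der(1)]) (use der(2) in simp)
    then have "((\<lambda>x. x) has_derivative (\<lambda>x. G' (G x))) (at z)"
      by (rule has_derivative_transform_within_open[OF _ op]) (use U U' inv in auto)
    then have "(\<lambda>x. G' (G x)) = (\<lambda>x. x)" using has_derivative_unique has_derivative_ident by blast
    then show ?thesis by metis
  qed
  define k :: "real \<times> 'a \<Rightarrow> real \<times> 'a" where "k = (\<lambda>(p, x). (p, g x))"
  have contk: "continuous_on (UNIV \<times> U) k"
    unfolding k_def case_prod_beta
    by (intro continuous_intros continuous_on_compose2[OF cont(1)]) auto
  define N1 where "N1 = (UNIV \<times> U) \<inter> k -` N"
  have N1: "open N1" unfolding N1_def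
    by (intro continuous_open_preimage contk open_Times U m) auto
  have contmk: "continuous_on N1 (\<lambda>y. m (k y))"
    by (rule continuous_on_compose2[OF m(3) continuous_on_subset[OF contk]]) (auto simp: N1_def)
  define N2 where "N2 = N1 \<inter> (\<lambda>y. m (k y)) -` U'"
  show ?thesis
    unfolding tangents_def mem_Collect_eq
  proof (intro exI[of _ "\<lambda>y. g' (m (k y))"] exI[of _ N2] conjI)
    show "open N2" unfolding N2_def by (intro continuous_open_preimage contmk N1 U')
    show "(0, z) \<in> N2" using U U' m by (auto simp: N2_def N1_def k_def)
    show "continuous_on N2 (\<lambda>y. g' (m (k y)))"
      by (rule continuous_on_compose2[OF cont(2) continuous_on_subset[OF contmk]]) (auto simp: N2_def)
    show "g' (m (k (0, z))) = z" using m U U' inv by (simp add: k_def)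
    show "\<forall>(p, x)\<in>N2. reach x (g' (m (k (p, x))))"
      using reach m(5) by (fastforce simp: N2_def N1_def k_def intro: rtranclp_trans)
    have "((\<lambda>y. (fst y, g (snd y))) has_derivative (\<lambda>y. (fst y, G (snd y)))) (at (0, z))"
    proof (rule has_derivative_Pair)
      show "((\<lambda>y. g (snd y)) has_derivative (\<lambda>y. G (snd y))) (at (0, z))"
        by (rule has_derivative_compose[of snd snd]) (use der(1) in \<open>auto intro!: derivative_eq_intros\<close>)
    qed (auto intro!: derivative_eq_intros)
    then have 1: "(k has_derivative (\<lambda>y. (fst y, G (snd y)))) (at (0, z))"
      by (simp add: k_def case_prod_beta')
    have 2: "((\<lambda>y. m (k y)) has_derivative (\<lambda>y. G (snd y) + fst y *\<^sub>R W)) (at (0, z))"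
      using has_derivative_compose[OF 1, of m "\<lambda>(p, h). h + p *\<^sub>R W"] m(6) by (simp add: k_def)
    have "((\<lambda>y. g' (m (k y))) has_derivative (\<lambda>y. G' (G (snd y) + fst y *\<^sub>R W))) (at (0, z))"
      by (rule has_derivative_compose[OF 2]) (use der(2) m(4) in \<open>simp add: k_def\<close>)
    then show "((\<lambda>y. g' (m (k y))) has_derivative (\<lambda>(p, h). h + p *\<^sub>R G' W)) (at (0, z))"
      by (simp add: G'.add G'.scaleR G'G case_prod_beta')
  qed
qed

text \<open>Along the flow \<open>\<Phi>\<close> of \<open>Y\<close> through \<open>q\<close>, the vectors \<open>\<Lambda> (-s) (\<Phi> s q) (W (\<Phi> s q))\<close> lie in the span of the tangents at
\<open>q\<close>, because tangents are pulled back. Their derivative at \<open>s = 0\<close> is the bracket, and a subspace of a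
finite-dimensional space is closed.\<close>

lemma bracket_in_span_tangents:
  assumes Y: "Y \<in> \<Y>" and C1: "C1_field \<Omega> Y Y'" and q: "q \<in> U" and U: "open U" "U \<subseteq> \<Omega>"
    and W: "\<And>z. z \<in> U \<Longrightarrow> W z \<in> span (tangents z)"
    and dW: "(W has_derivative W') (at q)"
  shows "W' (Y q) - Y' q (W q) \<in> span (tangents q)"
proof -
  have q\<Omega>: "q \<in> \<Omega>" using q U by blast
  obtain r \<Phi> \<Lambda> where f: "r > 0" "ball q r \<subseteq> \<Omega>"
    "\<And>s z. \<lbrakk>\<bar>s\<bar> < r; z \<in> ball q r\<rbrakk> \<Longrightarrow> reach z (\<Phi> s z)"
    "\<And>s z. \<lbrakk>\<bar>s\<bar> < r; z \<in> ball q r; \<Phi> s z \<in> ball q r\<rbrakk> \<Longrightarrow> \<Phi> (-s) (\<Phi> s z) = z"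
    "\<And>s z. \<lbrakk>\<bar>s\<bar> < r; z \<in> ball q r\<rbrakk> \<Longrightarrow> (\<Phi> s has_derivative blinfun_apply (\<Lambda> s z)) (at z)"
    "\<And>e. e > 0 \<Longrightarrow> \<exists>\<delta>>0. \<forall>s z. \<bar>s\<bar> < \<delta> \<longrightarrow> z \<in> ball q \<delta> \<longrightarrow>
       norm (\<Lambda> s z - id_blinfun - s *\<^sub>R Y' q) \<le> e * \<bar>s\<bar>"
    "\<Phi> 0 q = q"
    "\<And>s. \<bar>s\<bar> < r \<Longrightarrow> continuous_on (ball q r) (\<Phi> s)"
    "((\<lambda>s. \<Phi> s q) has_vector_derivative Y q) (at 0)"
    by (rule family_flow[OF Y C1 q\<Omega>]) blast
  define w where "w s = \<Phi> s q" for s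
  have w0: "w 0 = q" using f(7) by (simp add: w_def)
  have dw: "(w has_vector_derivative Y q) (at 0)" using f(9) by (simp add: w_def[abs_def])
  have lim_w: "(w \<longlongrightarrow> q) (at 0)"
    using has_vector_derivative_continuous[OF dw] w0 by (simp add: continuous_at)
  define D where "D s = \<Lambda> (-s) (w s) (W (w s))" for s
  have D_in: "D s \<in> span (tangents q)" if s: "\<bar>s\<bar> < r" and ws: "w s \<in> ball q r \<inter> U" for s
  proof -
    have "\<Lambda> (-s) (w s) ` tangents (w s) \<subseteq> tangents q"
    proof
      fix V assume "V \<in> \<Lambda> (-s) (w s) ` tangents (w s)"
      then obtain V' where V': "V' \<in> tangents (\<Phi> s q)" "V = \<Lambda> (-s) (\<Phi> s q) V'" by (auto simp: w_def)
      show "V \<in> tangents q"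
        unfolding V'(2)
        by (rule tangents_pullback[of "ball q r" q "ball q r" "\<Phi> s" "\<Phi> (-s)" "\<Lambda> s q"])
          (use f s ws V' in \<open>auto simp: w_def\<close>)
    qed
    then have "span (\<Lambda> (-s) (w s) ` tangents (w s)) \<subseteq> span (tangents q)" by (rule span_mono)
    then show ?thesis
      using W[of "w s"] ws linear_span_image[of "\<Lambda> (-s) (w s)" "tangents (w s)"]
      by (auto simp: D_def intro: bounded_linear.linear blinfun.bounded_linear_right)
  qed
  have dWw: "((\<lambda>s. W (w s)) has_vector_derivative W' (Y q)) (at 0)"
    using has_derivative_compose[OF dw[unfolded has_vector_derivative_def], of W W'] dW w0
      linear_scale[OF has_derivative_linear[OF dW]]
    by (simp add: has_vector_derivative_def)
  \<comment> \<open>The pullback \<open>D s\<close> splits into this term of order \<open>o(s)\<close> and two terms accessible to the chain rule.\<close>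
  define E where "E s = (\<Lambda> (-s) (w s) - id_blinfun - (-s) *\<^sub>R Y' q) (W (w s))" for s
  have dE: "(E has_vector_derivative 0) (at 0)"
  proof (rule has_vector_derivative_zero_if_small)
    fix e :: real assume e: "e > 0"
    define B where "B = norm (W q) + 1"
    have B: "B > 0" by (simp add: B_def add_nonneg_pos)
    obtain \<delta> where \<delta>: "\<delta> > 0" "\<And>s z. \<lbrakk>\<bar>s\<bar> < \<delta>; z \<in> ball q \<delta>\<rbrakk> \<Longrightarrow>
        norm (\<Lambda> s z - id_blinfun - s *\<^sub>R Y' q) \<le> e / B * \<bar>s\<bar>"
      using f(6)[of "e / B"] e B by auto
    have "((\<lambda>s. W (w s)) \<longlongrightarrow> W q) (at 0)"
      using has_vector_derivative_continuous[OF dWw] w0 by (simp add: continuous_at)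
    then have "\<forall>\<^sub>F s in at 0. dist (W (w s)) (W q) < 1" by (rule tendstoD) simp
    moreover have "\<forall>\<^sub>F s in at 0. dist (w s) q < \<delta>" using lim_w \<delta>(1) by (rule tendstoD)
    ultimately have "\<forall>\<^sub>F s in at 0. dist (W (w s)) (W q) < 1 \<and> dist (w s) q < \<delta>"
      by (rule eventually_conj)
    then obtain d where d: "d > 0" "\<And>s. \<lbrakk>s \<noteq> 0; \<bar>s\<bar> < d\<rbrakk> \<Longrightarrow> dist (W (w s)) (W q) < 1 \<and> dist (w s) q < \<delta>"
      unfolding eventually_at by (auto simp: dist_norm)
    have "norm (E s) \<le> e * \<bar>s\<bar>" if "\<bar>s\<bar> < min d \<delta>" for s
    proof -
      have ws: "w s \<in> ball q \<delta>" "norm (W (w s)) \<le> B"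
      proof -
        show "w s \<in> ball q \<delta>" using d(2)[of s] that \<delta>(1) w0 by (cases "s = 0") (auto simp: dist_commute)
        have "dist (W (w s)) (W q) < 1" using d(2)[of s] that w0 by (cases "s = 0") auto
        then show "norm (W (w s)) \<le> B" using norm_triangle_sub[of "W (w s)" "W q"] by (simp add: B_def dist_norm)
      qed
      have "norm (E s) \<le> norm (\<Lambda> (-s) (w s) - id_blinfun - (-s) *\<^sub>R Y' q) * norm (W (w s))"
        unfolding E_def by (rule norm_blinfun)
      also have "\<dots> \<le> (e / B * \<bar>s\<bar>) * B"
        using \<delta>(2)[of "-s" "w s"] that ws e B by (intro mult_mono) auto
      finally show ?thesis using B by simp
    qed
    then show "\<exists>\<delta>>0. \<forall>s. \<bar>s\<bar> < \<delta> \<longrightarrow> norm (E s) \<le> e * \<bar>s\<bar>"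
      using d(1) \<delta>(1) by (intro exI[of _ "min d \<delta>"]) auto
  qed
  have dY: "((\<lambda>s. s *\<^sub>R Y' q (W (w s))) has_vector_derivative Y' q (W q)) (at 0)"
    using has_vector_derivative_scaleR[OF DERIV_ident
        bounded_linear.has_vector_derivative[OF blinfun.bounded_linear_right dWw, of "Y' q"]] w0
    by simp
  have D_eq: "D s = E s + W (w s) - s *\<^sub>R Y' q (W (w s))" for s
    by (simp add: D_def E_def blinfun.bilinear_simps)
  have dD: "(D has_vector_derivative 0 + W' (Y q) - Y' q (W q)) (at 0)"
    unfolding D_eq[abs_def] by (intro has_vector_derivative_diff has_vector_derivative_add dE dWw dY)
  have E0: "E 0 = 0"
  proof -
    obtain \<delta> where "\<delta> > 0" "\<forall>s z. \<bar>s\<bar> < \<delta> \<longrightarrow> z \<in> ball q \<delta> \<longrightarrow>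
       norm (\<Lambda> s z - id_blinfun - s *\<^sub>R Y' q) \<le> 1 * \<bar>s\<bar>" using f(6)[of 1] by auto
    from this(2)[rule_format, of 0 q] this(1) show ?thesis by (simp add: E_def w0)
  qed
  then have D0: "D 0 = W q" using D_eq[of 0] w0 by simp
  have "((\<lambda>s. (D s - D 0) /\<^sub>R s) \<longlongrightarrow> W' (Y q) - Y' q (W q)) (at 0)"
    using difference_quotient_tendsto[OF dD] by simp
  then show ?thesis
  proof (rule Lim_in_closed_set[rotated 3])
    show "closed (span (tangents q))" by (rule closed_subspace) simp
    have "\<forall>\<^sub>F s in at 0. w s \<in> ball q r \<inter> U"
      using lim_w by (rule topological_tendstoD) (use U q f(1) in \<open>auto\<close>)
    moreover have "\<forall>\<^sub>F s in at (0::real). \<bar>s\<bar> < r"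
      using f(1) unfolding eventually_at by (auto simp: dist_norm)
    ultimately show "\<forall>\<^sub>F s in at 0. (D s - D 0) /\<^sub>R s \<in> span (tangents q)"
      by eventually_elim (auto intro!: span_scale span_diff D_in simp: D0 W q)
  qed simp
qed

end

context control_family begin

section \<open>Openness of orbits\<close>

definition interior_orbit :: "'a \<Rightarrow> bool"
  where "interior_orbit z \<longleftrightarrow> (\<exists>U. open U \<and> z \<in> U \<and> (\<forall>x\<in>U. reach z x))"

text \<open>The families belonging to a basis \<open>B\<close> of tangents are composed, the one of \<open>b\<close> being run with the coordinate of the parameter
along \<open>b\<close> as amplitude. The derivative of the composition at \<open>0\<close> sums the coordinates back up, so it is the identity.\<close>

lemma interior_orbit_if_full_span:
  assumes full: "span (tangents z) = UNIV"
  shows "interior_orbit z"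
proof -
  obtain B where B: "B \<subseteq> tangents z" "independent B" "tangents z \<subseteq> span B"
    by (rule maximal_independent_subset[of "tangents z"])
  have spanB: "span B = UNIV"
    using full B(3) by (metis span_minimal subspace_span top.extremum_unique)
  have finB: "finite B" using B(2) independent_bound by blast
  have lin: "bounded_linear (\<lambda>h. representation B h b)" for b
    unfolding linear_conv_bounded_linear[symmetric]
    by (rule linearI) (use B(2) spanB in \<open>simp_all add: representation_add representation_scale\<close>)
  have "\<exists>f U. open U \<and> 0 \<in> U \<and> continuous_on U f \<and> f 0 = z \<and> (\<forall>p\<in>U. reach z (f p)) \<and>
      (f has_derivative (\<lambda>h. \<Sum>b\<in>C. representation B h b *\<^sub>R b)) (at 0)" if "C \<subseteq> B" for C
    using finite_subset[OF that finB] that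
  proof (induction C)
    case empty
    then show ?case by (intro exI[of _ "\<lambda>_. z"] exI[of _ UNIV]) auto
  next
    case (insert b C)
    obtain f U where f: "open U" "0 \<in> U" "continuous_on U f" "f 0 = z" "\<And>p. p \<in> U \<Longrightarrow> reach z (f p)"
      "(f has_derivative (\<lambda>h. \<Sum>b\<in>C. representation B h b *\<^sub>R b)) (at 0)"
      using insert.IH insert.prems by auto
    have "b \<in> tangents z" using insert.prems B(1) by auto
    then obtain m N where m: "open N" "(0, z) \<in> N" "continuous_on N m" "m (0, z) = z"
      "\<And>p x. (p, x) \<in> N \<Longrightarrow> reach x (m (p, x))"
      "(m has_derivative (\<lambda>(p :: real, h). h + p *\<^sub>R b)) (at (0, z))"
      unfolding tangents_def by blast
    define k where "k p = (representation B p b, f p)" for p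
    have contk: "continuous_on U k"
      unfolding k_def by (intro continuous_intros f linear_continuous_on lin)
    have k0: "k 0 = (0, z)" using f by (simp add: k_def representation_zero)
    have dk: "(k has_derivative (\<lambda>h. (representation B h b, \<Sum>b\<in>C. representation B h b *\<^sub>R b))) (at 0)"
      unfolding k_def by (intro has_derivative_Pair bounded_linear_imp_has_derivative lin f)
    have "((\<lambda>p. m (k p)) has_derivative (\<lambda>h. (\<Sum>b\<in>C. representation B h b *\<^sub>R b) + representation B h b *\<^sub>R b)) (at 0)"
      using has_derivative_compose[OF dk, of m "\<lambda>(p, h). h + p *\<^sub>R b"] m(6) k0 by simp
    then have d: "((\<lambda>p. m (k p)) has_derivative (\<lambda>h. \<Sum>b\<in>insert b C. representation B h b *\<^sub>R b)) (at 0)"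
      using insert.hyps by (simp add: add.commute)
    show ?case
    proof (intro exI[of _ "\<lambda>p. m (k p)"] exI[of _ "U \<inter> k -` N"] conjI d)
      show "open (U \<inter> k -` N)" by (intro continuous_open_preimage contk f m)
      show "continuous_on (U \<inter> k -` N) (\<lambda>p. m (k p))"
        by (rule continuous_on_compose2[OF m(3) continuous_on_subset[OF contk]]) auto
      show "\<forall>p\<in>U \<inter> k -` N. reach z (m (k p))"
        using f(5) m(5) by (fastforce simp: k_def intro: rtranclp_trans)
    qed (use f m k0 in auto)
  qed
  from this[of B] obtain f U where f: "open U" "0 \<in> U" "continuous_on U f" "f 0 = z"
      "\<And>p. p \<in> U \<Longrightarrow> reach z (f p)"
      "(f has_derivative (\<lambda>h. \<Sum>b\<in>B. representation B h b *\<^sub>R b)) (at 0)" by blast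
  have "(\<Sum>b\<in>B. representation B h b *\<^sub>R b) = h" for h
    by (rule sum_representation_eq) (use B finB spanB in auto)
  then have df: "(f has_derivative id) (at 0)" using f(6) by (simp add: id_def)
  have "f 0 \<in> interior (f ` U)"
    by (rule sussmann_open_mapping[OF f(1,3,2) df, of id]) (use f in \<open>auto simp: interior_open id_def\<close>)
  then show ?thesis
    unfolding interior_orbit_def using f(4,5) interior_subset
    by (intro exI[of _ "interior (f ` U)"]) auto
qed

text \<open>Transport of openness along a flow: if \<open>f\<close> vanishes at \<open>q\<close> with nonzero derivative along \<open>Y\<close>, then a short run of \<open>Y\<close>
reaches a point with \<open>f \<noteq> 0\<close>, and nearby points are carried into the neighbourhood that exists there.\<close>

lemma interior_orbit_via_nonzero:
  assumes Y: "Y \<in> \<Y>" and q: "q \<in> \<Omega>"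
    and df: "(f has_derivative f') (at q)" and nz: "f' (Y q) \<noteq> 0"
    and good: "\<And>z. \<lbrakk>z \<in> \<Omega>; f z \<noteq> 0\<rbrakk> \<Longrightarrow> interior_orbit z"
  shows "interior_orbit q"
proof (cases "f q = 0")
  case True
  obtain Y' where C1: "C1_field \<Omega> Y Y'" using smooth[OF Y] by blast
  obtain r \<Phi> where F: "r > 0" "ball q r \<subseteq> \<Omega>"
    "\<And>s z. \<lbrakk>\<bar>s\<bar> < r; z \<in> ball q r\<rbrakk> \<Longrightarrow> reach z (\<Phi> s z)"
    "\<Phi> 0 q = q"
    "\<And>s. \<bar>s\<bar> < r \<Longrightarrow> continuous_on (ball q r) (\<Phi> s)"
    "((\<lambda>s. \<Phi> s q) has_vector_derivative Y q) (at 0)"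
    by (rule family_flow[OF Y C1 q]) blast
  have d: "((\<lambda>s. f (\<Phi> s q)) has_vector_derivative f' (Y q)) (at 0)"
    using has_derivative_compose[OF F(6)[unfolded has_vector_derivative_def], of f f'] df F(4)
      linear_scale[OF has_derivative_linear[OF df]]
    by (simp add: has_vector_derivative_def)
  have "((\<lambda>s. f (\<Phi> s q) /\<^sub>R s) \<longlongrightarrow> f' (Y q)) (at 0)"
    using difference_quotient_tendsto[OF d] True F(4) by simp
  then have "\<forall>\<^sub>F s in at 0. f (\<Phi> s q) /\<^sub>R s \<noteq> 0"
    using nz by (rule tendsto_imp_eventually_ne)
  moreover have "\<forall>\<^sub>F s in at (0::real). \<bar>s\<bar> < r"
    using F(1) unfolding eventually_at by (auto simp: dist_norm)
  moreover have "(\<lambda>s. \<Phi> s q) \<midarrow>0\<rightarrow> q"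
    using has_vector_derivative_continuous[OF F(6)] F(4) by (simp add: continuous_at)
  then have "\<forall>\<^sub>F s in at 0. \<Phi> s q \<in> ball q r" by (rule topological_tendstoD) (use F(1) in auto)
  ultimately have "\<forall>\<^sub>F s in at 0. f (\<Phi> s q) /\<^sub>R s \<noteq> 0 \<and> \<bar>s\<bar> < r \<and> \<Phi> s q \<in> ball q r"
    by (intro eventually_conj)
  then have "\<exists>s. f (\<Phi> s q) /\<^sub>R s \<noteq> 0 \<and> \<bar>s\<bar> < r \<and> \<Phi> s q \<in> ball q r"
    by (rule eventually_happens'[rotated]) simp
  then obtain s where s: "f (\<Phi> s q) \<noteq> 0" "\<bar>s\<bar> < r" "\<Phi> s q \<in> ball q r" by auto
  then have "interior_orbit (\<Phi> s q)" using good F(2) by blast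
  then obtain U where U: "open U" "\<Phi> s q \<in> U" "\<And>x. x \<in> U \<Longrightarrow> reach (\<Phi> s q) x"
    unfolding interior_orbit_def by blast
  have "reach q x" if "x \<in> ball q r \<inter> \<Phi> s -` U" for x
    using F(1) F(3)[OF s(2), of q] U(3)[of "\<Phi> s x"] reach_sym[OF F(3)[OF s(2), of x]] that
    by (auto intro: rtranclp_trans)
  moreover have "open (ball q r \<inter> \<Phi> s -` U)"
    by (intro continuous_open_preimage F s U) auto
  ultimately show ?thesis
    unfolding interior_orbit_def using U(2) F(1) by (intro exI[of _ "ball q r \<inter> \<Phi> s -` U"]) auto
qed (use good q in blast)

lemma reach_if_connected:
  assumes "connected \<Omega>" "\<And>z. z \<in> \<Omega> \<Longrightarrow> interior_orbit z" "z \<in> \<Omega>" "w \<in> \<Omega>"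
  shows "reach z w"
proof (rule connected_equivalence_relation[OF assms(1,3,4)])
  fix a assume "a \<in> \<Omega>"
  then obtain U where "open U" "a \<in> U" "\<forall>x\<in>U. reach a x"
    using assms(2) unfolding interior_orbit_def by blast
  then show "\<exists>T. openin (top_of_set \<Omega>) T \<and> a \<in> T \<and> (\<forall>x\<in>T. reach a x)"
    using \<open>a \<in> \<Omega>\<close> by (intro exI[of _ "\<Omega> \<inter> U"]) (auto simp: openin_open)
qed (auto intro: reach_sym rtranclp_trans)

end

section \<open>Stokeslets, rotlets and their brackets\<close>

definition stokeslet :: "real \<Rightarrow> real^3 \<Rightarrow> real^3 \<Rightarrow> real^3"
  where "stokeslet e v d =
    (e * inverse (norm d)) *\<^sub>R v + (e * inverse (norm d) ^ 3 * (d \<bullet> v)) *\<^sub>R d"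

definition stokeslet_deriv :: "real \<Rightarrow> real^3 \<Rightarrow> real^3 \<Rightarrow> real^3 \<Rightarrow> real^3"
  where "stokeslet_deriv e v d k =
    (- e * inverse (norm d) ^ 3 * (d \<bullet> k)) *\<^sub>R v
    + (e * inverse (norm d) ^ 3 * (k \<bullet> v) - 3 * e * inverse (norm d) ^ 5 * (d \<bullet> v) * (d \<bullet> k)) *\<^sub>R d
    + (e * inverse (norm d) ^ 3 * (d \<bullet> v)) *\<^sub>R k"

text \<open>The coefficient \<open>2 e / |d|\<^sup>3\<close> is that of the flow around a point torque; the second term is the
correction caused by the drift of the passive particle during the bracket motion.\<close>

definition rotlet_strength :: "real \<Rightarrow> real^3 \<Rightarrow> real"
  where "rotlet_strength e d = 2 * e * inverse (norm d) ^ 3 - 3 * e\<^sup>2 * inverse (norm d) ^ 4"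

definition rotlet :: "real \<Rightarrow> real^3 \<Rightarrow> real^3 \<Rightarrow> real^3"
  where "rotlet e w d = rotlet_strength e d *\<^sub>R cross3 w d"

definition rotlet_deriv :: "real \<Rightarrow> real^3 \<Rightarrow> real^3 \<Rightarrow> real^3 \<Rightarrow> real^3"
  where "rotlet_deriv e w d k =
    (- 6 * e * inverse (norm d) ^ 5 * (1 - 2 * e * inverse (norm d)) * (d \<bullet> k)) *\<^sub>R cross3 w d
    + rotlet_strength e d *\<^sub>R cross3 w k"

lemma mobility_eq_stokeslet: "mobility a d *v v = stokeslet (3 * a / 4) v d"
proof -
  have "(d \<otimes>\<^sub>v d) *v v = (d \<bullet> v) *\<^sub>R d"
    by (simp add: tensor_def vec_eq_iff matrix_vector_mult_def matrix_matrix_mult_def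
        columnvector_def rowvector_def inner_vec_def sum_distrib_left mult_ac)
  then have "mobility a d *v v = (3 * a / 4) *\<^sub>R ((1 / norm d) *\<^sub>R v + (1 / norm d ^ 3) *\<^sub>R ((d \<bullet> v) *\<^sub>R d))"
    by (simp only: mobility_def matrix_vector_mult_add_rdistrib scaleR_matrix_vector_assoc[symmetric] matrix_vector_mul_lid)
  also have "\<dots> = stokeslet (3 * a / 4) v d"
    by (simp only: stokeslet_def divide_inverse power_inverse[symmetric] power_one scaleR_add_right scaleR_scaleR
        mult_1 mult.assoc)
  finally show ?thesis .
qed

lemma has_derivative_inverse_norm_power:
  fixes d :: "'a::real_inner"
  assumes "d \<noteq> 0"
  shows "((\<lambda>d. inverse (norm d) ^ n) has_derivative
    (\<lambda>k. - real n * inverse (norm d) ^ (n + 2) * (d \<bullet> k))) (at d)"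
proof -
  have "((\<lambda>d. inverse (norm d)) has_derivative (\<lambda>k. - (inverse (norm d) * (sgn d \<bullet> k) * inverse (norm d)))) (at d)"
    using assms by (auto intro!: derivative_eq_intros has_derivative_norm simp: inner_commute)
  then have 1: "((\<lambda>d. inverse (norm d)) has_derivative (\<lambda>k. - (inverse (norm d) ^ 3) * (d \<bullet> k))) (at d)"
    by (simp add: sgn_div_norm power3_eq_cube mult_ac)
  show ?thesis
  proof (cases n)
    case (Suc m)
    have "inverse (norm d) ^ 3 * inverse (norm d) ^ (n - 1) = inverse (norm d) ^ (n + 2)"
    proof -
      have "3 + (n - 1) = n + 2" using Suc by simp
      then show ?thesis by (simp only: power_add[symmetric])
    qed
    then show ?thesis
      by (intro has_derivative_eq_rhs[OF has_derivative_power[OF 1]] ext)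
        (simp only: mult_minus_left mult_minus_right mult_ac)
  qed simp
qed

lemma has_derivative_stokeslet:
  assumes "d \<noteq> 0"
  shows "(stokeslet e v has_derivative stokeslet_deriv e v d) (at d)"
proof -
  note inv = has_derivative_inverse_norm_power[OF assms]
  have "((\<lambda>d. (e * inverse (norm d) ^ 1) *\<^sub>R v + (e * inverse (norm d) ^ 3 * (d \<bullet> v)) *\<^sub>R d) has_derivative
      stokeslet_deriv e v d) (at d)"
    unfolding stokeslet_deriv_def
    by (rule derivative_eq_intros inv refl)+
      (simp add: fun_eq_iff algebra_simps eval_nat_numeral flip: scaleR_add_left)
  then show ?thesis by (simp add: stokeslet_def[abs_def])
qed

lemma has_derivative_rotlet:
  assumes "d \<noteq> 0"
  shows "(rotlet e w has_derivative rotlet_deriv e w d) (at d)"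
proof -
  note inv = has_derivative_inverse_norm_power[OF assms]
  have cr: "((\<lambda>d. cross3 w d) has_derivative (\<lambda>k. cross3 w k)) (at d)"
    by (intro linear_imp_has_derivative linearI) (simp_all add: cross_add_right cross_mult_right)
  let ?c = "- 6 * e * inverse (norm d) ^ 5 * (1 - 2 * e * inverse (norm d))"
  have st: "(rotlet_strength e has_derivative (\<lambda>k. ?c * (d \<bullet> k))) (at d)"
    unfolding rotlet_strength_def[abs_def]
    by (rule has_derivative_eq_rhs[OF has_derivative_diff[OF
          has_derivative_mult_right[OF inv[of 3]] has_derivative_mult_right[OF inv[of 4]]]])
      (simp add: fun_eq_iff algebra_simps eval_nat_numeral)
  have "(rotlet e w has_derivative (\<lambda>k. rotlet_strength e d *\<^sub>R cross3 w k + (?c * (d \<bullet> k)) *\<^sub>R cross3 w d)) (at d)"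
    unfolding rotlet_def[abs_def] by (rule has_derivative_scaleR[OF st cr])
  then show ?thesis by (simp only: rotlet_deriv_def[abs_def] add.commute)
qed

lemma inverse_norm_cube_inner:
  fixes d :: "'a::real_inner"
  shows "inverse (norm d) ^ 3 * (d \<bullet> d) = inverse (norm d)"
  by (cases "d = 0") (simp_all add: dot_square_norm power_inverse field_simps eval_nat_numeral)

text \<open>The velocity of the distance vector \<open>d\<close> is \<open>stokeslet e v d - v\<close>. Up to the factor \<open>|d|\<close> this is its radial part, which
degenerates exactly at \<open>|d| = 2 e\<close>; the condition \<open>2 e < R\<close> comes from here.\<close>

lemma inner_drift:
  assumes "d \<noteq> 0"
  shows "d \<bullet> (stokeslet e v d - v) = (d \<bullet> v) * (2 * e * inverse (norm d) - 1)"
proof -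
  have "e * inverse (norm d) ^ 3 * (d \<bullet> v) * (d \<bullet> d) = e * inverse (norm d) * (d \<bullet> v)"
    using arg_cong[OF inverse_norm_cube_inner[of d], of "\<lambda>r. e * (d \<bullet> v) * r"] by (simp only: mult_ac)
  then show ?thesis
    by (simp add: stokeslet_def inner_add_right inner_diff_right algebra_simps)
qed

text \<open>The left side is an antisymmetrization in \<open>v\<close> and \<open>v'\<close>. The terms along \<open>d\<close> in each derivative are symmetric and cancel, so only a
multiple of \<open>(d \<bullet> v) v' - (d \<bullet> v') v\<close> survives.\<close>

lemma stokeslet_bracket:
  assumes "d \<noteq> 0"
  shows "stokeslet_deriv e v' d (stokeslet e v d - v) - stokeslet_deriv e v d (stokeslet e v' d - v')
    = rotlet e (cross3 v v') d"
proof -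
  define \<rho> A B C where "\<rho> = inverse (norm d)" and "A = d \<bullet> v" and "B = d \<bullet> v'" and "C = v \<bullet> v'"
  have CC: "v' \<bullet> v = v \<bullet> v'" by (rule inner_commute)
  have 1: "(stokeslet e v d - v) \<bullet> v' = e * \<rho> * C + e * \<rho> ^ 3 * A * B - C"
    "(stokeslet e v' d - v') \<bullet> v = e * \<rho> * C + e * \<rho> ^ 3 * A * B - C"
    by (simp_all add: stokeslet_def inner_add_left inner_diff_left \<rho>_def A_def B_def C_def CC)
  have 2: "cross3 (cross3 v v') d = A *\<^sub>R v' - B *\<^sub>R v"
    by (subst cross_skew) (simp add: Lagrange A_def B_def)
  show ?thesis
    unfolding stokeslet_deriv_def rotlet_def rotlet_strength_def inner_drift[OF assms] 1 2
    unfolding stokeslet_def \<rho>_def[symmetric] A_def[symmetric] B_def[symmetric] vec_eq_iff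
    by (simp add: algebra_simps eval_nat_numeral)
qed

lemma rotlet_bracket:
  assumes "d \<noteq> 0"
  shows "rotlet_deriv e w d (stokeslet e v d - v) - stokeslet_deriv e v d (rotlet e w d)
    = (6 * e * inverse (norm d) ^ 5 * (1 - 2 * e * inverse (norm d))\<^sup>2 * (d \<bullet> v)) *\<^sub>R cross3 w d
    + (rotlet_strength e d * (e * inverse (norm d) - 1)) *\<^sub>R cross3 w v
    - (e * inverse (norm d) ^ 3 * rotlet_strength e d * (cross3 w d \<bullet> v)) *\<^sub>R d"
proof -
  define \<rho> A \<phi> K where "\<rho> = inverse (norm d)" and "A = d \<bullet> v" and "\<phi> = rotlet_strength e d"
    and "K = cross3 w d \<bullet> v"
  have 1: "cross3 w (stokeslet e v d - v) =
      (e * \<rho>) *\<^sub>R cross3 w v + (e * \<rho> ^ 3 * A) *\<^sub>R cross3 w d - cross3 w v"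
    by (simp add: stokeslet_def cross_add_right cross_mult_right Cross3.right_diff_distrib \<rho>_def A_def)
  have 2: "d \<bullet> rotlet e w d = 0" "rotlet e w d \<bullet> v = \<phi> * K"
    by (simp_all add: rotlet_def dot_cross_self \<phi>_def K_def)
  show ?thesis
    unfolding stokeslet_deriv_def rotlet_deriv_def inner_drift[OF assms] 1 2
    unfolding rotlet_def \<rho>_def[symmetric] A_def[symmetric] \<phi>_def[symmetric] K_def[symmetric] vec_eq_iff
    by (simp add: algebra_simps eval_nat_numeral)
qed

text \<open>Distance vectors from the active to the passive particles. All fields depend on the configuration only through them,
and the brackets act on the two passive particles separately.\<close>

definition rel1 :: "config \<Rightarrow> real^3" where "rel1 z = fst (snd z) - fst z"
definition rel2 :: "config \<Rightarrow> real^3" where "rel2 z = snd (snd z) - fst z"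

text \<open>The active particle has velocity \<open>v\<close>, and both passive ones follow the same one-particle field \<open>g\<close>.\<close>

definition lift_field :: "real^3 \<Rightarrow> (real^3 \<Rightarrow> real^3) \<Rightarrow> config \<Rightarrow> config"
  where "lift_field v g z = (v, g (rel1 z), g (rel2 z))"

lemma rel_lift_field [simp]:
  "rel1 (lift_field v g z) = g (rel1 z) - v" "rel2 (lift_field v g z) = g (rel2 z) - v"
  by (simp_all add: rel1_def rel2_def lift_field_def)

lemma rel_has_derivative: "(rel1 has_derivative rel1) F" "(rel2 has_derivative rel2) F"
  unfolding rel1_def[abs_def] rel2_def[abs_def] by (auto intro!: derivative_eq_intros)

lemma has_derivative_lift_field:
  assumes "(g has_derivative g1) (at (rel1 z))" "(g has_derivative g2) (at (rel2 z))"
  shows "(lift_field v g has_derivative (\<lambda>h. (0, g1 (rel1 h), g2 (rel2 h)))) (at z)"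
  unfolding lift_field_def[abs_def]
  by (intro has_derivative_Pair has_derivative_const has_derivative_compose[OF rel_has_derivative(1)]
      has_derivative_compose[OF rel_has_derivative(2)] assms)

lemma C1_fieldI:
  fixes Y :: "'a::euclidean_space \<Rightarrow> 'a"
  assumes der: "\<And>z. z \<in> \<Omega> \<Longrightarrow> (Y has_derivative D z) (at z)"
    and cont: "\<And>h. continuous_on \<Omega> (\<lambda>z. D z h)"
  shows "C1_field \<Omega> Y (\<lambda>z. Blinfun (D z))"
proof -
  have *: "blinfun_apply (Blinfun (D z)) = D z" if "z \<in> \<Omega>" for z
    using has_derivative_bounded_linear[OF der[OF that]] by (rule bounded_linear_Blinfun_apply)
  have "continuous_on \<Omega> (\<lambda>z. Blinfun (D z))"
    by (rule continuous_on_blinfun_componentwise)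
      (use cont * in \<open>simp cong: continuous_on_cong\<close>)
  then show ?thesis using der * by (simp add: C1_field_def)
qed

lemma rel_nonzero:
  assumes "z \<in> separated R" "R \<ge> 0"
  shows "R < norm (rel1 z)" "R < norm (rel2 z)" "rel1 z \<noteq> 0" "rel2 z \<noteq> 0" "rel1 z \<noteq> rel2 z"
  using assms by (auto simp: separated_def rel1_def rel2_def norm_minus_commute)

lemma open_separated: "open (separated R)"
proof -
  have "separated R = {z. R < norm (rel1 z)} \<inter> {z. R < norm (rel2 z)} \<inter> {z. R < norm (rel1 z - rel2 z)}"
    by (auto simp: separated_def rel1_def rel2_def norm_minus_commute)
  moreover have "open {z. R < norm (rel1 z)}" "open {z. R < norm (rel2 z)}" "open {z. R < norm (rel1 z - rel2 z)}"
    unfolding rel1_def rel2_def by (intro open_Collect_less continuous_intros)+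
  ultimately show ?thesis by auto
qed

definition stokes_field_deriv :: "real \<Rightarrow> real^3 \<Rightarrow> config \<Rightarrow> config \<Rightarrow> config"
  where "stokes_field_deriv e v z h =
    (0, stokeslet_deriv e v (rel1 z) (rel1 h), stokeslet_deriv e v (rel2 z) (rel2 h))"

lemma has_derivative_stokes_field:
  assumes "rel1 z \<noteq> 0" "rel2 z \<noteq> 0"
  shows "(lift_field v (stokeslet e v) has_derivative stokes_field_deriv e v z) (at z)"
  unfolding stokes_field_deriv_def[abs_def]
  by (intro has_derivative_lift_field has_derivative_stokeslet assms)

lemma C1_stokes_field:
  assumes "R \<ge> 0"
  shows "C1_field (separated R) (lift_field v (stokeslet e v)) (\<lambda>z. Blinfun (stokes_field_deriv e v z))"
proof (rule C1_fieldI)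
  note nz = rel_nonzero[OF _ assms]
  have cr: "continuous_on (separated R) rel1" "continuous_on (separated R) rel2"
    unfolding rel1_def[abs_def] rel2_def[abs_def] by (intro continuous_intros)+
  show "continuous_on (separated R) (\<lambda>z. stokes_field_deriv e v z h)" for h
    unfolding stokes_field_deriv_def stokeslet_deriv_def
    by (intro continuous_intros cr) (use nz in auto)
qed (use rel_nonzero[OF _ assms] in \<open>auto intro: has_derivative_stokes_field\<close>)

definition stokes_fields :: "real \<Rightarrow> (config \<Rightarrow> config) set"
  where "stokes_fields e = range (\<lambda>v. lift_field v (stokeslet e v))"

lemma control_family_stokes:
  assumes "R \<ge> 0"
  shows "control_family (separated R) (stokes_fields e)"
proof
  fix Y s assume "Y \<in> stokes_fields e"
  then obtain v where "Y = lift_field v (stokeslet e v)" by (auto simp: stokes_fields_def)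
  then have "(\<lambda>z. s *\<^sub>R Y z) = lift_field (s *\<^sub>R v) (stokeslet e (s *\<^sub>R v))"
    by (simp add: fun_eq_iff lift_field_def stokeslet_def scaleR_add_right mult_ac)
  then show "(\<lambda>z. s *\<^sub>R Y z) \<in> stokes_fields e" by (auto simp: stokes_fields_def)
qed (use C1_stokes_field[OF assms] open_separated in \<open>auto simp: stokes_fields_def\<close>)

lemma exists_orthogonal3:
  obtains u :: "real^3" where "u \<noteq> 0" "u \<bullet> w = 0"
proof (cases "w = 0")
  case True
  then show thesis using that[of "axis 1 1"] by (simp add: axis_eq_0_iff)
next
  case False
  then obtain i :: 3 where "cross3 w (axis i 1) \<noteq> 0" using cross_basis_nonzero by blast
  then show thesis using that by (simp add: dot_cross_self)
qed

lemma cross3_surj: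
  obtains v v' where "w = cross3 v v'"
proof -
  obtain u where u: "u \<noteq> 0" "u \<bullet> w = 0" by (rule exists_orthogonal3)
  have "cross3 u (cross3 w u) = (u \<bullet> u) *\<^sub>R w" by (simp add: Lagrange u)
  then have "w = cross3 (inverse (u \<bullet> u) *\<^sub>R u) (cross3 w u)" using u by (simp add: cross_mult_left)
  then show thesis by (rule that)
qed

lemma zero_if_cross3_zero: "\<lbrakk>cross3 v u = 0; v \<bullet> u = 0; v \<noteq> 0\<rbrakk> \<Longrightarrow> u = 0" for u v :: "real^3"
  using Lagrange[of v v u] by simp

lemma parallel_if_cross3_zero:
  assumes "cross3 d p = 0" "d \<noteq> 0"
  shows "p = ((d \<bullet> p) / (d \<bullet> d)) *\<^sub>R d"
proof -
  have "(d \<bullet> p) *\<^sub>R d = (d \<bullet> d) *\<^sub>R p" using Lagrange[of d d p] assms by simp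
  then have "((d \<bullet> p) / (d \<bullet> d)) *\<^sub>R d = inverse (d \<bullet> d) *\<^sub>R ((d \<bullet> d) *\<^sub>R p)"
    by (metis divide_inverse mult.commute scaleR_scaleR)
  then show ?thesis using assms by simp
qed

lemma zero_if_inner_all_zero: "(\<And>w. w \<bullet> u = 0) \<Longrightarrow> u = 0" for u :: "'a::real_inner"
  by (metis inner_eq_zero_iff)

text \<open>The linear algebra behind controllability: a covector \<open>(p1, p2)\<close> annihilating all rotlets and their brackets with the
Stokes fields is zero. The rotlets make the torques \<open>\<phi>\<^sub>j d\<^sub>j \<times> p\<^sub>j\<close> cancel; let \<open>c\<close> be the first one. The brackets then give
\<open>(D \<bullet> v) c + v \<times> Q = 0\<close> for all \<open>v\<close>, where \<open>D\<close> is a combination of \<open>d1\<close> and \<open>d2\<close> that is nonzero because these are independent. Taking the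
inner product with \<open>v\<close> removes \<open>Q\<close> and forces \<open>c = 0\<close>, then \<open>Q = 0\<close>. So each \<open>p\<^sub>j\<close> is parallel to \<open>d\<^sub>j\<close>, and \<open>Q = 0\<close> is a linear
relation between \<open>d1\<close> and \<open>d2\<close> whose coefficients vanish only with \<open>p1\<close> and \<open>p2\<close>.\<close>

lemma noncollinear_dual_trivial:
  fixes d1 d2 p1 p2 :: "real^3"
  assumes nc: "cross3 d1 d2 \<noteq> 0" and e: "e > 0"
    and far: "2 * e < norm d1" "2 * e < norm d2"
    and rot: "\<And>w. rotlet e w d1 \<bullet> p1 + rotlet e w d2 \<bullet> p2 = 0"
    and br: "\<And>v w. (rotlet_deriv e w d1 (stokeslet e v d1 - v) - stokeslet_deriv e v d1 (rotlet e w d1)) \<bullet> p1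
      + (rotlet_deriv e w d2 (stokeslet e v d2 - v) - stokeslet_deriv e v d2 (rotlet e w d2)) \<bullet> p2 = 0"
  shows "p1 = 0 \<and> p2 = 0"
proof -
  have d: "d1 \<noteq> 0" "d2 \<noteq> 0" using nc by auto
  define \<rho>1 \<rho>2 \<phi>1 \<phi>2 where \<rho>: "\<rho>1 = inverse (norm d1)" "\<rho>2 = inverse (norm d2)"
    and \<phi>: "\<phi>1 = rotlet_strength e d1" "\<phi>2 = rotlet_strength e d2"
  have \<rho>b: "0 < \<rho>1" "0 < \<rho>2" "2 * e * \<rho>1 < 1" "2 * e * \<rho>2 < 1"
    using d far by (simp_all add: \<rho> field_simps)
  have \<phi>': "\<phi>1 = e * \<rho>1 ^ 3 * (2 - 3 * e * \<rho>1)" "\<phi>2 = e * \<rho>2 ^ 3 * (2 - 3 * e * \<rho>2)"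
    by (simp_all add: \<phi> \<rho> rotlet_strength_def algebra_simps eval_nat_numeral)
  have \<phi>b: "0 < \<phi>1" "0 < \<phi>2"
    unfolding \<phi>' using \<rho>b e by (intro mult_pos_pos zero_less_power; linarith)+
  define c where "c = \<phi>1 *\<^sub>R cross3 d1 p1"
  have trip: "cross3 w d \<bullet> p = w \<bullet> cross3 d p" for w d p :: "real^3"
    by (metis cross_triple inner_commute)
  have c2: "\<phi>2 *\<^sub>R cross3 d2 p2 = - c"
  proof -
    have "w \<bullet> (c + \<phi>2 *\<^sub>R cross3 d2 p2) = 0" for w
      using rot[of w] by (simp add: rotlet_def trip c_def \<phi> inner_add_right)
    then have "c + \<phi>2 *\<^sub>R cross3 d2 p2 = 0" by (rule zero_if_inner_all_zero)
    then show ?thesis by (simp add: eq_neg_iff_add_eq_0 add.commute)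
  qed
  define \<chi>1 \<chi>2 where \<chi>: "\<chi>1 = 6 * e * \<rho>1 ^ 5 * (1 - 2 * e * \<rho>1)\<^sup>2 / \<phi>1" "\<chi>2 = 6 * e * \<rho>2 ^ 5 * (1 - 2 * e * \<rho>2)\<^sup>2 / \<phi>2"
  have \<chi>b: "\<chi>1 > 0" using \<rho>b \<phi>b e by (simp add: \<chi>)
  define D where "D = \<chi>1 *\<^sub>R d1 - \<chi>2 *\<^sub>R d2"
  define Q where "Q = (\<phi>1 * (e * \<rho>1 - 1)) *\<^sub>R p1 + (e * \<rho>1 ^ 3 * \<phi>1 * (d1 \<bullet> p1)) *\<^sub>R d1
    + (\<phi>2 * (e * \<rho>2 - 1)) *\<^sub>R p2 + (e * \<rho>2 ^ 3 * \<phi>2 * (d2 \<bullet> p2)) *\<^sub>R d2"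
  have key: "(D \<bullet> v) *\<^sub>R c + cross3 v Q = 0" for v
  proof (rule zero_if_inner_all_zero)
    fix w
    have c1': "(6 * e * \<rho>1 ^ 5 * (1 - 2 * e * \<rho>1)\<^sup>2 * (d1 \<bullet> v)) * (w \<bullet> cross3 d1 p1) = \<chi>1 * (d1 \<bullet> v) * (w \<bullet> c)"
      using \<phi>b by (simp add: c_def \<chi>)
    have "\<chi>2 * (d2 \<bullet> v) * (w \<bullet> (- c)) = (6 * e * \<rho>2 ^ 5 * (1 - 2 * e * \<rho>2)\<^sup>2 * (d2 \<bullet> v)) * (w \<bullet> cross3 d2 p2)"
      unfolding c2[symmetric] using \<phi>b by (simp add: \<chi>)
    then have c2': "(6 * e * \<rho>2 ^ 5 * (1 - 2 * e * \<rho>2)\<^sup>2 * (d2 \<bullet> v)) * (w \<bullet> cross3 d2 p2) = - \<chi>2 * (d2 \<bullet> v) * (w \<bullet> c)"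
      by simp
    have sk: "w \<bullet> cross3 d v = - (w \<bullet> cross3 v d)" for d by (metis cross_skew inner_minus_right)
    have "\<chi>1 * (d1 \<bullet> v) * (w \<bullet> c) + (\<phi>1 * (e * \<rho>1 - 1)) * (w \<bullet> cross3 v p1)
        + (e * \<rho>1 ^ 3 * \<phi>1 * (w \<bullet> cross3 v d1)) * (d1 \<bullet> p1)
        + (- \<chi>2 * (d2 \<bullet> v) * (w \<bullet> c) + (\<phi>2 * (e * \<rho>2 - 1)) * (w \<bullet> cross3 v p2)
        + (e * \<rho>2 ^ 3 * \<phi>2 * (w \<bullet> cross3 v d2)) * (d2 \<bullet> p2)) = 0"
      using br[of w v]
      unfolding rotlet_bracket[OF d(1)] rotlet_bracket[OF d(2)] \<rho>[symmetric] \<phi>[symmetric]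
        inner_add_left inner_diff_left inner_scaleR_left trip c1' c2' sk
      by simp
    then show "w \<bullet> ((D \<bullet> v) *\<^sub>R c + cross3 v Q) = 0"
      by (simp add: D_def Q_def inner_diff_left inner_add_right inner_diff_right cross_add_right
          Cross3.right_diff_distrib cross_mult_right algebra_simps)
  qed
  have "D \<noteq> 0"
  proof
    assume "D = 0"
    then have "cross3 D d2 = 0" by simp
    then show False using nc \<chi>b by (simp add: D_def Cross3.left_diff_distrib cross_mult_left)
  qed
  have Dc: "(D \<bullet> v) * (c \<bullet> v) = 0" for v
    using arg_cong[OF key[of v], of "\<lambda>u. u \<bullet> v"] by (simp add: inner_add_left dot_cross_self)
  \<comment> \<open>The product of the two linear forms vanishes identically; testing on \<open>D\<close> and on \<open>D + c\<close> shows \<open>c = 0\<close>.\<close>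
  have "c = 0"
  proof -
    have "D \<bullet> c = 0" using Dc[of D] \<open>D \<noteq> 0\<close> by (simp add: inner_commute)
    then have "(D \<bullet> D) * (c \<bullet> c) = 0"
      using Dc[of "D + c"] by (simp add: inner_add_right inner_commute)
    then show ?thesis using \<open>D \<noteq> 0\<close> by simp
  qed
  have "Q = 0"
  proof -
    obtain u where u: "u \<noteq> 0" "u \<bullet> Q = 0" by (rule exists_orthogonal3)
    then show ?thesis using key[of u] \<open>c = 0\<close> zero_if_cross3_zero[of u Q] by simp
  qed
  have "cross3 d1 p1 = 0" "cross3 d2 p2 = 0"
    using c2 \<open>c = 0\<close> \<phi>b by (auto simp: c_def)
  then obtain l1 l2 where l: "p1 = l1 *\<^sub>R d1" "p2 = l2 *\<^sub>R d2"
    using parallel_if_cross3_zero d by metis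
  have \<rho>3: "\<rho>1 ^ 3 * (d1 \<bullet> d1) = \<rho>1" "\<rho>2 ^ 3 * (d2 \<bullet> d2) = \<rho>2"
    by (simp_all add: \<rho> inverse_norm_cube_inner)
  have "Q = (\<phi>1 * l1 * (e * \<rho>1 - 1) + \<phi>1 * l1 * e * (\<rho>1 ^ 3 * (d1 \<bullet> d1))) *\<^sub>R d1
      + (\<phi>2 * l2 * (e * \<rho>2 - 1) + \<phi>2 * l2 * e * (\<rho>2 ^ 3 * (d2 \<bullet> d2))) *\<^sub>R d2"
    unfolding Q_def l by (simp add: algebra_simps)
  also have "\<dots> = (\<phi>1 * l1 * (2 * e * \<rho>1 - 1)) *\<^sub>R d1 + (\<phi>2 * l2 * (2 * e * \<rho>2 - 1)) *\<^sub>R d2"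
    unfolding \<rho>3 by (simp add: algebra_simps)
  finally have Q: "(\<phi>1 * l1 * (2 * e * \<rho>1 - 1)) *\<^sub>R d1 + (\<phi>2 * l2 * (2 * e * \<rho>2 - 1)) *\<^sub>R d2 = 0"
    using \<open>Q = 0\<close> by simp
  from arg_cong[OF Q, of "\<lambda>u. cross3 u d2"] have "l1 = 0"
    using nc \<rho>b \<phi>b by (simp add: cross_add_left cross_mult_left)
  moreover from arg_cong[OF Q, of "\<lambda>u. cross3 d1 u"] have "l2 = 0"
    using nc \<rho>b \<phi>b by (simp add: cross_add_right cross_mult_right)
  ultimately show ?thesis by (simp add: l)
qed

section \<open>Local controllability of the particle system\<close>

locale stokes_system =
  fixes e R :: real
  assumes e_pos: "e > 0" and e_less: "2 * e < R"
begin

lemma R_pos: "R \<ge> 0" using e_pos e_less by simp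

sublocale control_family "separated R" "stokes_fields e"
  by (rule control_family_stokes[OF R_pos])

lemma stokes_field_mem: "lift_field v (stokeslet e v) \<in> stokes_fields e"
  by (simp add: stokes_fields_def)

lemma bracket_with_stokes_field:
  assumes z: "z \<in> separated R"
    and W: "\<And>z. z \<in> separated R \<Longrightarrow> W z \<in> span (tangents z)"
    and dW: "(W has_derivative W') (at z)"
  shows "W' (lift_field v (stokeslet e v) z) - stokes_field_deriv e v z (W z) \<in> span (tangents z)"
proof -
  have "(lift_field v (stokeslet e v) has_derivative stokes_field_deriv e v z) (at z)"
    using rel_nonzero[OF z R_pos] by (intro has_derivative_stokes_field)
  then have "blinfun_apply (Blinfun (stokes_field_deriv e v z)) = stokes_field_deriv e v z"
    by (intro bounded_linear_Blinfun_apply has_derivative_bounded_linear)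
  then show ?thesis
    using bracket_in_span_tangents[OF stokes_field_mem[of v] C1_stokes_field[OF R_pos] z open_separated order_refl W dW]
    by simp
qed

text \<open>Every vector \<open>w\<close> is a cross product \<open>v \<times> v'\<close>, so every rotlet is the bracket of two Stokes fields.\<close>

lemma rotlet_in_span:
  assumes z: "z \<in> separated R"
  shows "lift_field 0 (rotlet e w) z \<in> span (tangents z)"
proof -
  obtain v v' where w: "w = cross3 v v'" by (rule cross3_surj)
  note nz = rel_nonzero[OF z R_pos]
  have "stokes_field_deriv e v' z (lift_field v (stokeslet e v) z)
      - stokes_field_deriv e v z (lift_field v' (stokeslet e v') z) \<in> span (tangents z)"
    by (intro bracket_with_stokes_field z has_derivative_stokes_field nz span_base
        field_in_tangents stokes_field_mem)
  also have "stokes_field_deriv e v' z (lift_field v (stokeslet e v) z)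
      - stokes_field_deriv e v z (lift_field v' (stokeslet e v') z) = lift_field 0 (rotlet e w) z"
    by (simp add: stokes_field_deriv_def w stokeslet_bracket nz) (simp add: lift_field_def)
  finally show ?thesis .
qed

lemma rotlet_bracket_in_span:
  assumes z: "z \<in> separated R"
  shows "lift_field 0 (\<lambda>d. rotlet_deriv e w d (stokeslet e v d - v) - stokeslet_deriv e v d (rotlet e w d)) z
    \<in> span (tangents z)"
proof -
  note nz = rel_nonzero[OF z R_pos]
  have "(lift_field 0 (rotlet e w) has_derivative
      (\<lambda>h. (0, rotlet_deriv e w (rel1 z) (rel1 h), rotlet_deriv e w (rel2 z) (rel2 h)))) (at z)"
    by (intro has_derivative_lift_field has_derivative_rotlet nz)
  from bracket_with_stokes_field[OF z rotlet_in_span this, of v] show ?thesis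
    by (simp add: stokes_field_deriv_def) (simp add: lift_field_def)
qed

lemma interior_orbit_noncollinear:
  assumes z: "z \<in> separated R" and nc: "cross3 (rel1 z) (rel2 z) \<noteq> 0"
  shows "interior_orbit z"
proof (rule interior_orbit_if_full_span, rule ccontr)
  assume "span (tangents z) \<noteq> UNIV"
  then obtain p where p: "p \<noteq> 0" "\<And>u. u \<in> span (tangents z) \<Longrightarrow> p \<bullet> u = 0"
    using span_not_UNIV_orthogonal by blast
  obtain p0 p1 p2 where pp: "p = (p0, p1, p2)" by (cases p)
  note far = rel_nonzero[OF z R_pos]
  have "p1 = 0 \<and> p2 = 0"
  proof (rule noncollinear_dual_trivial[OF nc e_pos])
    show "rotlet e w (rel1 z) \<bullet> p1 + rotlet e w (rel2 z) \<bullet> p2 = 0" for w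
      using p(2)[OF rotlet_in_span[OF z, of w]] by (simp add: pp lift_field_def inner_commute)
    show "(rotlet_deriv e w (rel1 z) (stokeslet e v (rel1 z) - v) - stokeslet_deriv e v (rel1 z) (rotlet e w (rel1 z))) \<bullet> p1
      + (rotlet_deriv e w (rel2 z) (stokeslet e v (rel2 z) - v) - stokeslet_deriv e v (rel2 z) (rotlet e w (rel2 z))) \<bullet> p2 = 0"
      for v w
      using p(2)[OF rotlet_bracket_in_span[OF z, of w v]]
      by (simp add: pp lift_field_def inner_commute[of p1] inner_commute[of p2])
  qed (use far e_less in auto)
  moreover have "p \<bullet> lift_field v (stokeslet e v) z = 0" for v
    by (intro p(2) span_base field_in_tangents stokes_field_mem z)
  ultimately have "p0 \<bullet> v = 0" for v by (simp add: pp lift_field_def)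
  then have "p0 = 0" by (metis inner_eq_zero_iff)
  with \<open>p1 = 0 \<and> p2 = 0\<close> p(1) show False by (simp add: pp zero_prod_def)
qed

text \<open>In a collinear configuration the active particle is pushed along some \<open>v\<close> orthogonal to the common line. Both distance vectors
then move along \<open>v\<close>, with factors \<open>-\<beta>1\<close> and \<open>-\<beta>2\<close>, and their cross product has derivative \<open>v \<times> u\<close> with
\<open>u = \<beta>2 d1 - \<beta>1 d2\<close>. This \<open>u\<close> is nonzero: otherwise comparing norms would give \<open>|d1| = |d2|\<close>, and then \<open>d1 = d2\<close>.\<close>

lemma interior_orbit_all:
  assumes z: "z \<in> separated R"
  shows "interior_orbit z"
proof (cases "cross3 (rel1 z) (rel2 z) = 0")
  case True
  define d1 d2 where d: "d1 = rel1 z" "d2 = rel2 z"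
  note far = rel_nonzero[OF z R_pos, folded d]
  define \<beta>1 \<beta>2 where \<beta>: "\<beta>1 = 1 - e * inverse (norm d1)" "\<beta>2 = 1 - e * inverse (norm d2)"
  have pos: "norm d1 > 0" "norm d2 > 0" using far by auto
  have \<beta>pos: "\<beta>1 > 1/2" "\<beta>2 > 1/2"
    using far(1,2) e_less pos by (auto simp: \<beta> field_simps)
  define u where "u = \<beta>2 *\<^sub>R d1 - \<beta>1 *\<^sub>R d2"
  have "u \<noteq> 0"
  proof
    assume "u = 0"
    then have eq: "\<beta>2 *\<^sub>R d1 = \<beta>1 *\<^sub>R d2" by (simp add: u_def)
    then have "norm (\<beta>2 *\<^sub>R d1) = norm (\<beta>1 *\<^sub>R d2)" by simp
    then have "\<beta>2 * norm d1 = \<beta>1 * norm d2" using \<beta>pos by simp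
    then have "(norm d1 - norm d2) * (norm d1 * norm d2 - e * (norm d1 + norm d2)) = 0"
      using pos by (simp add: \<beta> field_simps)
    moreover have "norm d1 * norm d2 - e * (norm d1 + norm d2) > 0"
    proof -
      have "2 * e * norm d2 < norm d1 * norm d2" "norm d1 * (2 * e) < norm d1 * norm d2"
        using far(1,2) e_less pos by (auto intro!: mult_strict_right_mono mult_strict_left_mono)
      then show ?thesis by (simp add: algebra_simps)
    qed
    ultimately have "norm d1 = norm d2" by simp
    then have "d1 = d2" using eq \<beta>pos by (simp add: \<beta>)
    then show False using far by simp
  qed
  obtain v :: "real^3" where v: "v \<noteq> 0" "v \<bullet> d1 = 0" by (rule exists_orthogonal3)
  have "d2 = ((d1 \<bullet> d2) / (d1 \<bullet> d1)) *\<^sub>R d1"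
    using True far by (intro parallel_if_cross3_zero) (auto simp: d)
  then have v2: "v \<bullet> d2 = 0" using v(2) by (metis inner_scaleR_right mult_zero_right)
  have "v \<bullet> u = 0" using v v2 by (simp add: u_def inner_diff_right)
  then have vu: "cross3 v u \<noteq> 0" using zero_if_cross3_zero v(1) \<open>u \<noteq> 0\<close> by blast
  have "bounded_bilinear (cross3 :: real^3 \<Rightarrow> _)"
    using bilinear_conv_bounded_bilinear bilinear_cross by blast
  then have df: "((\<lambda>z. cross3 (rel1 z) (rel2 z)) has_derivative
      (\<lambda>h. cross3 (rel1 z) (rel2 h) + cross3 (rel1 h) (rel2 z))) (at z)"
    by (intro bounded_bilinear.FDERIV rel_has_derivative)
  show ?thesis
  proof (rule interior_orbit_via_nonzero[OF stokes_field_mem[of v] z df])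
    have "stokeslet e v d1 - v = (- \<beta>1) *\<^sub>R v" "stokeslet e v d2 - v = (- \<beta>2) *\<^sub>R v"
      using v v2 by (simp_all add: stokeslet_def \<beta> inner_commute algebra_simps)
    then have "cross3 (rel1 z) (rel2 (lift_field v (stokeslet e v) z)) + cross3 (rel1 (lift_field v (stokeslet e v) z)) (rel2 z)
      = \<beta>2 *\<^sub>R (- cross3 d1 v) - \<beta>1 *\<^sub>R cross3 v d2"
      by (simp add: d[symmetric] cross_mult_left cross_mult_right)
    also have "- cross3 d1 v = cross3 v d1" by (metis cross_skew)
    also have "\<beta>2 *\<^sub>R cross3 v d1 - \<beta>1 *\<^sub>R cross3 v d2 = cross3 v u"
      by (simp add: u_def Cross3.right_diff_distrib cross_mult_right)
    finally show "cross3 (rel1 z) (rel2 (lift_field v (stokeslet e v) z))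
      + cross3 (rel1 (lift_field v (stokeslet e v) z)) (rel2 z) \<noteq> 0" using vu by simp
  qed (use interior_orbit_noncollinear in blast)
qed (use interior_orbit_noncollinear z in blast)

end

section \<open>Connectedness of the separated configurations\<close>

lemma path_component_continuous_image:
  assumes "path_connected S" "continuous_on S f" "f ` S \<subseteq> T" "x \<in> S" "y \<in> S"
  shows "path_component T (f x) (f y)"
proof -
  have "path_connected (f ` S)" using path_connected_continuous_image[OF assms(2,1)] .
  then show ?thesis
    using assms by (meson imageI path_component_of_subset path_connected_component)
qed

lemma path_connected_outside_cball:
  "path_connected {x :: real^3. r < norm (x - c)}"
proof -
  have "{x. r < norm (x - c)} = - cball c r" by (auto simp: dist_norm norm_minus_commute)
  then show ?thesis by (simp add: path_connected_complement_bounded_convex)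
qed

text \<open>The two excluded balls around \<open>y1\<close> and \<open>y2\<close> may overlap. Moving in a direction orthogonal to both \<open>x - y1\<close> and \<open>x - y2\<close> increases both
distances, so \<open>x\<close> escapes along a straight line to the exterior of one large ball, which is path connected.\<close>

lemma separated_active_to_far:
  assumes R: "R \<ge> 0" and z: "(x, y1, y2) \<in> separated R"
    and \<rho>: "norm y1 + R \<le> \<rho>" "norm y2 + R \<le> \<rho>" and x': "\<rho> < norm x'"
  shows "path_component (separated R) (x, y1, y2) (x', y1, y2)"
proof -
  obtain u where u: "norm u = 1" "u \<bullet> (x - y1) = 0" "u \<bullet> (x - y2) = 0"
  proof (cases "cross3 (x - y1) (x - y2) = 0")
    case True
    obtain v where v: "v \<noteq> 0" "v \<bullet> (x - y1) = 0" by (rule exists_orthogonal3)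
    have "x - y1 \<noteq> 0" using z R by (auto simp: separated_def)
    from parallel_if_cross3_zero[OF True this] v have "v \<bullet> (x - y2) = 0"
      by (metis inner_scaleR_right mult_zero_right)
    with v show thesis by (intro that[of "sgn v"]) (simp_all add: norm_sgn sgn_div_norm)
  next
    case False
    then show thesis
      by (intro that[of "sgn (cross3 (x - y1) (x - y2))"])
        (simp_all add: norm_sgn sgn_div_norm dot_cross_self)
  qed
  define s where "s = norm x + \<bar>\<rho>\<bar> + 1"
  have far: "R < norm (x + t *\<^sub>R u - y)" if "R < norm (x - y)" "u \<bullet> (x - y) = 0" for t y
  proof -
    have "(norm (x + t *\<^sub>R u - y))\<^sup>2 = (norm ((x - y) + t *\<^sub>R u))\<^sup>2" by (simp add: algebra_simps)
    also have "\<dots> = (norm (x - y))\<^sup>2 + (norm (t *\<^sub>R u))\<^sup>2"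
      using that(2) by (intro norm_add_Pythagorean) (simp add: orthogonal_def inner_commute)
    finally have "(norm (x - y))\<^sup>2 \<le> (norm (x + t *\<^sub>R u - y))\<^sup>2" by simp
    then have "norm (x - y) \<le> norm (x + t *\<^sub>R u - y)" by (simp add: power2_le_iff_abs_le)
    then show ?thesis using that(1) by simp
  qed
  have "path_component (separated R) (x + 0 *\<^sub>R u, y1, y2) (x + s *\<^sub>R u, y1, y2)"
    by (rule path_component_continuous_image[of UNIV "\<lambda>t. (x + t *\<^sub>R u, y1, y2)"])
      (use z u far in \<open>auto simp: separated_def intro!: continuous_intros\<close>)
  moreover have "path_component (separated R) (x + s *\<^sub>R u, y1, y2) (x', y1, y2)"
  proof (rule path_component_continuous_image[of "{x. \<rho> < norm (x - 0)}" "\<lambda>x. (x, y1, y2)"])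
    show "(\<lambda>x. (x, y1, y2)) ` {x. \<rho> < norm (x - 0)} \<subseteq> separated R"
    proof clarsimp
      fix x :: "real^3" assume "\<rho> < norm x"
      then show "(x, y1, y2) \<in> separated R"
        using \<rho> z norm_triangle_ineq2[of x y1] norm_triangle_ineq2[of x y2] by (auto simp: separated_def)
    qed
    have "norm (s *\<^sub>R u) \<le> norm (x + s *\<^sub>R u) + norm x"
      using norm_triangle_ineq4[of "x + s *\<^sub>R u" x] by simp
    then show "x + s *\<^sub>R u \<in> {x. \<rho> < norm (x - 0)}" using u(1) by (simp add: s_def)
  qed (use x' path_connected_outside_cball[of \<rho> 0] in \<open>auto intro!: continuous_intros\<close>)
  ultimately have "path_component (separated R) (x + 0 *\<^sub>R u, y1, y2) (x', y1, y2)"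
    by (rule path_component_trans)
  then show ?thesis by simp
qed

text \<open>The pair of passive particles can be moved along a path in the set of separated pairs, after the active particle has been
parked outside a ball that leaves a margin \<open>R\<close> around that path.\<close>

lemma connected_separated:
  assumes R: "R \<ge> 0"
  shows "connected (separated R)"
proof -
  define P :: "((real^3) \<times> (real^3)) set" where "P = {(y1, y2). R < norm (y1 - y2)}"
  have pcP: "path_connected P"
  proof -
    have "P = (\<lambda>(c, w). (c, c + w)) ` (UNIV \<times> {w. R < norm (w - 0)})"
    proof (intro set_eqI iffI)
      fix p assume "p \<in> P"
      then show "p \<in> (\<lambda>(c, w). (c, c + w)) ` (UNIV \<times> {w. R < norm (w - 0)})"
        by (intro image_eqI[of _ _ "(fst p, snd p - fst p)"]) (auto simp: P_def norm_minus_commute)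
    qed (auto simp: P_def)
    moreover have "path_connected ((\<lambda>(c, w). (c, c + w)) ` (UNIV \<times> {w :: real^3. R < norm (w - 0)}))"
      unfolding case_prod_beta
      by (intro path_connected_continuous_image path_connected_Times path_connected_outside_cball
          continuous_intros) auto
    ultimately show ?thesis by simp
  qed
  have "path_component (separated R) z z'" if zs: "z \<in> separated R" "z' \<in> separated R" for z z'
  proof -
    obtain x y1 y2 x' y1' y2' where zz: "z = (x, y1, y2)" "z' = (x', y1', y2')"
      by (metis prod_cases3)
    have "(y1, y2) \<in> P" "(y1', y2') \<in> P" using zs by (auto simp: zz separated_def P_def)
    then obtain g where g: "path g" "path_image g \<subseteq> P" "pathstart g = (y1, y2)" "pathfinish g = (y1', y2')"
      using pcP unfolding path_connected_def by blast
    have "bounded (path_image g)" using g(1) by (rule bounded_path_image)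
    then obtain b where b: "\<And>p. p \<in> path_image g \<Longrightarrow> norm p \<le> b" by (auto simp: bounded_iff)
    define \<rho> where "\<rho> = b + R"
    have \<rho>: "norm (fst p) + R \<le> \<rho>" "norm (snd p) + R \<le> \<rho>" if "p \<in> path_image g" for p
      using b[OF that] norm_fst_le[of "fst p" "snd p"] norm_snd_le[of "snd p" "fst p"] by (simp_all add: \<rho>_def)
    obtain xf :: "real^3" where xf: "\<rho> < norm xf"
      using vector_choose_size[of "\<bar>\<rho>\<bar> + 1"] by (metis abs_ge_self abs_ge_zero add_nonneg_nonneg less_add_one order_le_less_trans zero_le_one)
    have ends: "(y1, y2) \<in> path_image g" "(y1', y2') \<in> path_image g"
      using g(3,4) pathstart_in_path_image pathfinish_in_path_image by metis+
    have "path_component (separated R) z (xf, y1, y2)"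
      unfolding zz using \<rho>[OF ends(1)] xf zs by (intro separated_active_to_far[OF R]) (auto simp: zz)
    moreover have "path_component (separated R) (xf, (y1, y2)) (xf, (y1', y2'))"
    proof (rule path_component_continuous_image[of "path_image g" "\<lambda>p. (xf, p)"])
      show "Pair xf ` path_image g \<subseteq> separated R"
      proof clarify
        fix q1 q2 assume q: "(q1, q2) \<in> path_image g"
        then show "(xf, q1, q2) \<in> separated R"
          using \<rho>[OF q] xf g(2) norm_triangle_ineq2[of xf q1] norm_triangle_ineq2[of xf q2]
          by (auto simp: separated_def P_def)
      qed
    qed (use g(1) ends in \<open>auto intro!: path_connected_path_image continuous_intros\<close>)
    moreover have "path_component (separated R) (xf, y1', y2') z'"
      unfolding zz using \<rho>[OF ends(2)] xf zs
      by (intro path_component_sym[OF separated_active_to_far[OF R]]) (auto simp: zz)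
    ultimately show ?thesis by (blast intro: path_component_trans)
  qed
  then show ?thesis
    by (simp add: path_connected_component path_connected_imp_connected)
qed

lemma (in stokes_system) reach_all:
  assumes "z \<in> separated R" "w \<in> separated R"
  shows "reach z w"
  using reach_if_connected[OF connected_separated[OF R_pos] interior_orbit_all assms] .

section \<open>Absolutely continuous functions\<close>

definition short_intervals :: "real set \<Rightarrow> real \<Rightarrow> nat \<Rightarrow> (nat \<Rightarrow> real) \<Rightarrow> (nat \<Rightarrow> real) \<Rightarrow> bool"
  where "short_intervals S \<delta> n l r \<longleftrightarrow> (\<forall>i<n. l i \<le> r i \<and> {l i..r i} \<subseteq> S) \<and>
    (\<forall>i<n. \<forall>j<n. i \<noteq> j \<longrightarrow> {l i<..<r i} \<inter> {l j<..<r j} = {}) \<and> (\<Sum>i<n. r i - l i) < \<delta>"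

lemma absolutely_continuous_on_iff:
  "absolutely_continuous_on S f \<longleftrightarrow> (\<forall>\<epsilon>>0. \<exists>\<delta>>0. \<forall>n l r. short_intervals S \<delta> n l r \<longrightarrow>
    (\<Sum>i<n. dist (f (l i)) (f (r i))) < \<epsilon>)"
  unfolding absolutely_continuous_on_def short_intervals_def ..

lemma short_intervals_mono:
  "\<lbrakk>short_intervals S \<delta> n l r; S \<subseteq> S'; \<delta> \<le> \<delta>'\<rbrakk> \<Longrightarrow> short_intervals S' \<delta>' n l r"
  unfolding short_intervals_def by (meson order_trans less_le_trans)

lemma short_intervals_endpoints:
  assumes "short_intervals S \<delta> n l r" "i < n"
  shows "l i \<in> S" "r i \<in> S" "l i \<le> r i"
  using assms unfolding short_intervals_def by (meson atLeastAtMost_iff order_refl subsetD)+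

lemma absolutely_continuous_on_subset:
  "\<lbrakk>absolutely_continuous_on S f; S' \<subseteq> S\<rbrakk> \<Longrightarrow> absolutely_continuous_on S' f"
  unfolding absolutely_continuous_on_iff by (meson short_intervals_mono order_refl)

lemma absolutely_continuous_on_dominated:
  assumes f: "absolutely_continuous_on S f" and g: "absolutely_continuous_on S g" and "K > 0"
    and dom: "\<And>s t. \<lbrakk>s \<in> S; t \<in> S\<rbrakk> \<Longrightarrow> dist (h s) (h t) \<le> K * (dist (f s) (f t) + dist (g s) (g t))"
  shows "absolutely_continuous_on S h"
  unfolding absolutely_continuous_on_iff
proof (intro allI impI)
  fix \<epsilon> :: real assume "\<epsilon> > 0"
  then have \<epsilon>: "\<epsilon> / (2 * K) > 0" using \<open>K > 0\<close> by simp
  obtain \<delta>1 where \<delta>1: "\<delta>1 > 0"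
    "\<And>n l r. short_intervals S \<delta>1 n l r \<Longrightarrow> (\<Sum>i<n. dist (f (l i)) (f (r i))) < \<epsilon> / (2 * K)"
    using f \<epsilon> unfolding absolutely_continuous_on_iff by blast
  obtain \<delta>2 where \<delta>2: "\<delta>2 > 0"
    "\<And>n l r. short_intervals S \<delta>2 n l r \<Longrightarrow> (\<Sum>i<n. dist (g (l i)) (g (r i))) < \<epsilon> / (2 * K)"
    using g \<epsilon> unfolding absolutely_continuous_on_iff by blast
  show "\<exists>\<delta>>0. \<forall>n l r. short_intervals S \<delta> n l r \<longrightarrow> (\<Sum>i<n. dist (h (l i)) (h (r i))) < \<epsilon>"
  proof (intro exI[of _ "min \<delta>1 \<delta>2"] conjI allI impI)
    fix n l r assume lr: "short_intervals S (min \<delta>1 \<delta>2) n l r"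
    have "(\<Sum>i<n. dist (h (l i)) (h (r i))) \<le> (\<Sum>i<n. K * (dist (f (l i)) (f (r i)) + dist (g (l i)) (g (r i))))"
      using short_intervals_endpoints[OF lr] by (intro sum_mono dom) auto
    also have "\<dots> = K * ((\<Sum>i<n. dist (f (l i)) (f (r i))) + (\<Sum>i<n. dist (g (l i)) (g (r i))))"
      by (simp add: sum.distrib flip: sum_distrib_left)
    also have "\<dots> < K * (\<epsilon> / (2 * K) + \<epsilon> / (2 * K))"
      using \<open>K > 0\<close>
      by (intro mult_strict_left_mono add_strict_mono \<delta>1(2) \<delta>2(2) short_intervals_mono[OF lr]) auto
    also have "\<dots> = \<epsilon>" using \<open>K > 0\<close> by (simp add: field_simps)
    finally show "(\<Sum>i<n. dist (h (l i)) (h (r i))) < \<epsilon>" .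
  qed (use \<delta>1 \<delta>2 in auto)
qed

lemma absolutely_continuous_on_id: "absolutely_continuous_on S (\<lambda>t :: real. t)"
  unfolding absolutely_continuous_on_iff
proof (intro allI impI)
  fix \<epsilon> :: real assume "\<epsilon> > 0"
  moreover have "(\<Sum>i<n. dist (l i) (r i)) < \<epsilon>" if lr: "short_intervals S \<epsilon> n l r" for n l r
  proof -
    have "(\<Sum>i<n. dist (l i) (r i)) = (\<Sum>i<n. r i - l i)"
      using short_intervals_endpoints(3)[OF lr] by (intro sum.cong) (auto simp: dist_real_def)
    then show ?thesis using lr by (simp add: short_intervals_def)
  qed
  ultimately show "\<exists>\<delta>>0. \<forall>n l r. short_intervals S \<delta> n l r \<longrightarrow> (\<Sum>i<n. dist (l i) (r i)) < \<epsilon>" by blast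
qed

lemma absolutely_continuous_on_lipschitz:
  assumes "L-lipschitz_on S f"
  shows "absolutely_continuous_on S f"
proof (rule absolutely_continuous_on_dominated[OF absolutely_continuous_on_id absolutely_continuous_on_id])
  fix s t assume "s \<in> S" "t \<in> S"
  then have "dist (f s) (f t) \<le> L * dist s t" by (rule lipschitz_onD[OF assms])
  also have "\<dots> \<le> (L + 1) * (dist s t + dist s t)"
    using lipschitz_on_nonneg[OF assms] by (intro mult_mono) auto
  finally show "dist (f s) (f t) \<le> (L + 1) * (dist s t + dist s t)" .
qed (use lipschitz_on_nonneg[OF assms] in auto)

lemma absolutely_continuous_on_imp_continuous_on:
  assumes "absolutely_continuous_on {a..b} f"
  shows "continuous_on {a..b} f"
  unfolding continuous_on_iff
proof (intro ballI allI impI)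
  fix s e :: real assume s: "s \<in> {a..b}" and "e > 0"
  then obtain \<delta> where \<delta>: "\<delta> > 0"
    "\<And>n l r. short_intervals {a..b} \<delta> n l r \<Longrightarrow> (\<Sum>i<n. dist (f (l i)) (f (r i))) < e"
    using assms unfolding absolutely_continuous_on_iff by blast
  have "dist (f t) (f s) < e" if t: "t \<in> {a..b}" "dist t s < \<delta>" for t
  proof -
    have "short_intervals {a..b} \<delta> 1 (\<lambda>_. min s t) (\<lambda>_. max s t)"
      using s t by (auto simp: short_intervals_def dist_real_def)
    from \<delta>(2)[OF this] show ?thesis by (cases "s \<le> t") (simp_all add: dist_commute)
  qed
  then show "\<exists>d>0. \<forall>x'\<in>{a..b}. dist x' s < d \<longrightarrow> dist (f x') (f s) < e"
    using \<delta>(1) by blast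
qed

text \<open>The intervals of a tagged division overlap in null sets only, so their lengths add up to at most the measure of a set containing them.\<close>

lemma tagged_division_small_tags:
  fixes a b :: real
  assumes p: "p tagged_division_of {a..b}" and q: "q \<subseteq> p"
    and U: "U \<in> lmeasurable" "\<And>x K. (x, K) \<in> q \<Longrightarrow> K \<subseteq> U"
  shows "(\<Sum>(x, K)\<in>q. Sup K - Inf K) \<le> measure lebesgue U"
proof -
  have fin: "finite q" using p q finite_subset by blast
  have iv: "\<exists>c d. K = {c..d} \<and> c \<le> d" if "(x, K) \<in> q" for x K
    using tagged_division_ofD(2,4)[OF p] that q by (fastforce simp: subset_iff)
  have "(\<Sum>(x, K)\<in>q. Sup K - Inf K) = (\<Sum>xK\<in>q. measure lebesgue (snd xK))"
    by (intro sum.cong) (auto dest!: iv)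
  also have "\<dots> = measure lebesgue (\<Union>(snd ` q))"
  proof (rule measure_negligible_finite_Union_image[symmetric, OF fin])
    show "snd xK \<in> lmeasurable" if "xK \<in> q" for xK
      using iv[of "fst xK" "snd xK"] that by auto
    show "pairwise (\<lambda>x y. negligible (snd x \<inter> snd y)) q"
    proof (intro pairwiseI)
      fix u v assume uv: "u \<in> q" "v \<in> q" "u \<noteq> v"
      then have "u \<in> p" "v \<in> p" using q by blast+
      then have "interior (snd u) \<inter> interior (snd v) = {}"
        using tagged_division_ofD(5)[OF p, of "fst u" "snd u" "fst v" "snd v"] uv(3) by simp
      moreover have "convex (snd u \<inter> snd v)"
        using iv[of "fst u" "snd u"] iv[of "fst v" "snd v"] uv by (auto intro: convex_Int)
      ultimately show "negligible (snd u \<inter> snd v)" by (simp add: negligible_convex_interior)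
    qed
  qed
  also have "\<dots> \<le> measure lebesgue U"
  proof (rule measure_mono_fmeasurable)
    show "\<Union>(snd ` q) \<in> sets lebesgue"
      using fin iv by (intro sets.finite_UN) force+
  qed (use U in fastforce)+
  finally show ?thesis .
qed

text \<open>A gauge is chosen so that intervals tagged outside \<open>N\<close> contribute at most \<open>\<epsilon>\<close> times their length, by the sign of the
derivative, while those tagged in \<open>N\<close> lie in an open set of measure below the \<open>\<delta>\<close> of absolute continuity, so
together they contribute at most \<open>\<epsilon>\<close>. The increment of \<open>g\<close> is the sum over a tagged division fine for this gauge.\<close>

lemma absolutely_continuous_nonincreasing:
  fixes g :: "real \<Rightarrow> real"
  assumes ac: "absolutely_continuous_on {a..b} g" and ab: "a \<le> b" and N: "negligible N"
    and der: "\<And>t. t \<in> {a..b} - N \<Longrightarrow> \<exists>D. (g has_real_derivative D) (at t within {a..b}) \<and> D \<le> 0"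
  shows "g b \<le> g a"
proof -
  have "g b - g a \<le> (b - a + 1) * \<epsilon>" if \<epsilon>: "\<epsilon> > 0" for \<epsilon>
  proof -
    obtain \<delta> where \<delta>: "\<delta> > 0"
      "\<And>n l r. short_intervals {a..b} \<delta> n l r \<Longrightarrow> (\<Sum>i<n. dist (g (l i)) (g (r i))) < \<epsilon>"
      using ac \<epsilon> unfolding absolutely_continuous_on_iff by blast
    have "N \<in> sets lebesgue" using N by (simp add: negligible_imp_sets)
    then obtain U where U: "open U" "N \<subseteq> U" "U - N \<in> lmeasurable" "emeasure lebesgue (U - N) < ennreal \<delta>"
      using sets_lebesgue_outer_open \<delta>(1) by blast
    have "U = (U - N) \<union> N" using U(2) by blast
    have "U - N \<union> N \<in> lmeasurable"
      using U(3) N by (intro fmeasurable.Un) (simp_all add: negligible_iff_measure)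
    then have Um: "U \<in> lmeasurable" using \<open>U = (U - N) \<union> N\<close> by simp
    have "emeasure lebesgue (U - N \<union> N) = emeasure lebesgue (U - N)"
      using N U(3) by (intro emeasure_Un_null_set) (simp_all add: negligible_iff_null_sets fmeasurableD)
    then have "emeasure lebesgue U = emeasure lebesgue (U - N)" using \<open>U = (U - N) \<union> N\<close> by simp
    with U(4) have "emeasure lebesgue U < ennreal \<delta>" by simp
    then have Uless: "measure lebesgue U < \<delta>"
      using Um \<delta>(1) by (simp add: emeasure_eq_measure2 ennreal_less_iff)
    have "\<exists>r>0. (t \<in> N \<longrightarrow> ball t r \<subseteq> U) \<and> (t \<in> {a..b} - N \<longrightarrow> (\<forall>c d. c \<le> t \<longrightarrow> t \<le> d \<longrightarrow>
        {c..d} \<subseteq> ball t r \<inter> {a..b} \<longrightarrow> g d - g c \<le> \<epsilon> * (d - c)))" for t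
    proof (cases "t \<in> {a..b} - N")
      case True
      then obtain D where D: "(g has_real_derivative D) (at t within {a..b})" "D \<le> 0" using der by blast
      from D(1) obtain r where r: "r > 0" "\<And>y. \<lbrakk>y \<in> {a..b}; norm (y - t) < r\<rbrakk> \<Longrightarrow>
          norm (g y - g t - D * (y - t)) \<le> \<epsilon> * norm (y - t)"
        using \<epsilon> unfolding has_field_derivative_def has_derivative_within_alt by blast
      have "g d - g c \<le> \<epsilon> * (d - c)" if cd: "c \<le> t" "t \<le> d" "{c..d} \<subseteq> ball t r \<inter> {a..b}" for c d
      proof -
        have "c \<in> {c..d}" "d \<in> {c..d}" using cd by auto
        then have in_ab: "c \<in> {a..b}" "d \<in> {a..b}" and in_ball: "norm (c - t) < r" "norm (d - t) < r"
          using cd(3) by (auto simp: dist_real_def subset_iff)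
        have "\<bar>g c - g t - D * (c - t)\<bar> \<le> \<epsilon> * (t - c)" "\<bar>g d - g t - D * (d - t)\<bar> \<le> \<epsilon> * (d - t)"
          using r(2)[OF in_ab(1) in_ball(1)] r(2)[OF in_ab(2) in_ball(2)] cd by auto
        then have "g d - g c \<le> D * (d - c) + \<epsilon> * (d - c)" by (simp add: algebra_simps)
        also have "\<dots> \<le> \<epsilon> * (d - c)" using D(2) cd by (simp add: mult_nonpos_nonneg)
        finally show ?thesis .
      qed
      then show ?thesis using r(1) True by blast
    next
      case False
      show ?thesis
      proof (cases "t \<in> N")
        case True
        then show ?thesis using False U(1,2) by (metis open_contains_ball subsetD)
      qed (use False zero_less_one in blast)
    qed
    then obtain rad where rad: "\<And>t. rad t > 0" "\<And>t. t \<in> N \<Longrightarrow> ball t (rad t) \<subseteq> U"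
      "\<And>t c d. \<lbrakk>t \<in> {a..b} - N; c \<le> t; t \<le> d; {c..d} \<subseteq> ball t (rad t) \<inter> {a..b}\<rbrakk> \<Longrightarrow> g d - g c \<le> \<epsilon> * (d - c)"
      by metis
    have "gauge (\<lambda>t. ball t (rad t))" using rad(1) by (simp add: gauge_def)
    then obtain p where p: "p tagged_division_of {a..b}" "(\<lambda>t. ball t (rad t)) fine p"
      by (rule fine_division_exists_real)
    have iv: "\<exists>c d. K = {c..d} \<and> c \<le> x \<and> x \<le> d \<and> {c..d} \<subseteq> ball x (rad x) \<inter> {a..b}" if "(x, K) \<in> p" for x K
      using tagged_division_ofD(2,3,4)[OF p(1) that] fineD[OF p(2) that] by fastforce
    have finp: "finite p" using p(1) by blast
    define q where "q = {xK \<in> p. fst xK \<in> N}"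
    have q: "q \<subseteq> p" "finite q" using finp by (auto simp: q_def)
    let ?\<Delta> = "\<lambda>h :: real \<Rightarrow> real. \<lambda>(x :: real, K). h (Sup K) - h (Inf K)"
    have bad: "sum (?\<Delta> g) q \<le> \<epsilon>"
    proof -
      obtain h where h: "bij_betw h {..<card q} q"
        using ex_bij_betw_nat_finite[OF q(2)] by (auto simp: atLeast0LessThan)
      define l r where "l i = Inf (snd (h i))" and "r i = Sup (snd (h i))" for i
      have hi: "h i \<in> q" if "i < card q" for i using h that by (auto simp: bij_betw_def)
      have lr: "snd (h i) = {l i..r i} \<and> l i \<le> r i \<and> {l i..r i} \<subseteq> {a..b}" if "i < card q" for i
      proof -
        have "(fst (h i), snd (h i)) \<in> p" using hi[OF that] q(1) by auto
        from iv[OF this] obtain c d where "snd (h i) = {c..d}" "c \<le> d" "{c..d} \<subseteq> {a..b}"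
          by (metis inf.boundedE order_trans)
        then show ?thesis by (simp add: l_def r_def)
      qed
      have "(\<Sum>i<card q. dist (g (l i)) (g (r i))) < \<epsilon>"
      proof (rule \<delta>(2), unfold short_intervals_def, intro conjI allI impI)
        show "{l i<..<r i} \<inter> {l j<..<r j} = {}" if ij: "i < card q" "j < card q" "i \<noteq> j" for i j
        proof -
          have "h i \<noteq> h j" using h ij by (auto simp: bij_betw_def inj_on_def)
          moreover have "h i \<in> p" "h j \<in> p" using hi ij q(1) by blast+
          ultimately have "interior (snd (h i)) \<inter> interior (snd (h j)) = {}"
            using tagged_division_ofD(5)[OF p(1), of "fst (h i)" "snd (h i)" "fst (h j)" "snd (h j)"] by simp
          then show ?thesis using lr[OF ij(1)] lr[OF ij(2)] by simp
        qed
        have "(\<Sum>i<card q. r i - l i) = (\<Sum>xK\<in>q. Sup (snd xK) - Inf (snd xK))"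
          unfolding l_def r_def using sum.reindex_bij_betw[OF h, of "\<lambda>xK. Sup (snd xK) - Inf (snd xK)"] by simp
        also have "\<dots> = (\<Sum>(x, K)\<in>q. Sup K - Inf K)" by (simp add: case_prod_beta)
        also have "\<dots> \<le> measure lebesgue U"
        proof (rule tagged_division_small_tags[OF p(1) q(1) Um])
          show "K \<subseteq> U" if "(x, K) \<in> q" for x K
            using iv[of x K] rad(2)[of x] that by (auto simp: q_def)
        qed
        finally show "(\<Sum>i<card q. r i - l i) < \<delta>" using Uless by simp
      qed (use lr in blast)+
      moreover have "sum (?\<Delta> g) q = (\<Sum>i<card q. g (r i) - g (l i))"
        unfolding l_def r_def case_prod_beta
        using sum.reindex_bij_betw[OF h, of "\<lambda>xK. g (Sup (snd xK)) - g (Inf (snd xK))"] by simp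
      moreover have "(\<Sum>i<card q. g (r i) - g (l i)) \<le> (\<Sum>i<card q. dist (g (l i)) (g (r i)))"
        by (intro sum_mono) (simp add: dist_real_def)
      ultimately show ?thesis by simp
    qed
    have good: "sum (?\<Delta> g) (p - q) \<le> \<epsilon> * (b - a)"
    proof -
      have "sum (?\<Delta> g) (p - q) \<le> (\<Sum>xK\<in>p - q. \<epsilon> * ?\<Delta> (\<lambda>t. t) xK)"
      proof (intro sum_mono)
        fix xK assume "xK \<in> p - q"
        then obtain x K where xK: "xK = (x, K)" "(x, K) \<in> p" "x \<notin> N" by (cases xK) (auto simp: q_def)
        from iv[OF xK(2)] obtain c d where cd: "K = {c..d}" "c \<le> x" "x \<le> d" "{c..d} \<subseteq> ball x (rad x) \<inter> {a..b}" by blast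
        then have "x \<in> {a..b} - N" using xK(3) by (auto simp: subset_iff)
        from rad(3)[OF this cd(2-4)] show "?\<Delta> g xK \<le> \<epsilon> * ?\<Delta> (\<lambda>t. t) xK" using xK(1) cd by simp
      qed
      also have "\<dots> \<le> (\<Sum>xK\<in>p. \<epsilon> * ?\<Delta> (\<lambda>t. t) xK)"
        using \<epsilon> finp iv by (intro sum_mono2) fastforce+
      also have "\<dots> = \<epsilon> * (b - a)"
        using additive_tagged_division_1[OF ab p(1), of "\<lambda>t. t"] by (simp add: sum_distrib_left[symmetric])
      finally show ?thesis .
    qed
    have "g b - g a = sum (?\<Delta> g) p" using additive_tagged_division_1[OF ab p(1), of g] by simp
    also have "\<dots> = sum (?\<Delta> g) (p - q) + sum (?\<Delta> g) q" using q(1) finp by (rule sum.subset_diff)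
    also have "\<dots> \<le> \<epsilon> * (b - a) + \<epsilon>" using good bad by (rule add_mono)
    finally show ?thesis by (simp add: algebra_simps)
  qed
  note bound = this
  show ?thesis
  proof (rule ccontr)
    assume "\<not> g b \<le> g a"
    then have "(g b - g a) / (2 * (b - a + 1)) > 0" using ab by simp
    from bound[OF this] have "g b - g a \<le> (b - a + 1) * ((g b - g a) / (2 * (b - a + 1)))" .
    also have "\<dots> = (g b - g a) / 2" using ab by (simp add: field_simps)
    finally have "g b - g a \<le> (g b - g a) / 2" .
    then show False using \<open>\<not> g b \<le> g a\<close> by simp
  qed
qed

section \<open>Uniqueness of solutions\<close>

text \<open>The function \<open>exp (-2 M t) |w t|\<^sup>2\<close> is absolutely continuous, nonnegative, zero at time \<open>0\<close>, and its derivative is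
nonpositive almost everywhere.\<close>

lemma gronwall_zero:
  fixes w :: "real \<Rightarrow> 'a::real_inner"
  assumes ac: "absolutely_continuous_on {0..T} w" and w0: "w 0 = 0" and N: "negligible N"
    and der: "\<And>t. t \<in> {0..T} - N \<Longrightarrow>
      \<exists>D. (w has_vector_derivative D) (at t within {0..T}) \<and> norm D \<le> L * norm (w t)"
    and t: "t \<in> {0..T}"
  shows "w t = 0"
proof -
  define M where "M = max L 0"
  have M: "M \<ge> 0" "\<And>r. r \<ge> 0 \<Longrightarrow> L * r \<le> M * r" by (auto simp: M_def intro: mult_right_mono)
  have "compact (w ` {0..T})"
    by (intro compact_continuous_image absolutely_continuous_on_imp_continuous_on ac) auto
  then obtain B where B: "B > 0" "\<And>t. t \<in> {0..T} \<Longrightarrow> norm (w t) \<le> B"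
    using compact_imp_bounded by (metis bounded_pos imageI)
  define g where "g t = exp (- 2 * M * t) * (w t \<bullet> w t)" for t
  have "absolutely_continuous_on {0..T} g"
  proof (rule absolutely_continuous_on_dominated[OF ac absolutely_continuous_on_id])
    show "0 < 2 * B + 2 * M * B\<^sup>2" using B M by (simp add: add_pos_nonneg)
    fix s t assume st: "s \<in> {0..T}" "t \<in> {0..T}"
    have dexp: "(exp has_derivative (\<lambda>h. h * exp x)) (at x within {..0})" for x :: real
      by (auto intro!: derivative_eq_intros)
    have "norm (exp (- 2 * M * s) - exp (- 2 * M * t)) \<le> 1 * norm ((- 2 * M * s) - (- 2 * M * t))"
    proof (rule differentiable_bound[of "{..0::real}"])
      show "onorm (\<lambda>h. h * exp x) \<le> 1" if "x \<in> {..0}" for x :: real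
        by (rule onorm_le) (use that in \<open>auto simp: abs_mult intro: mult_left_le\<close>)
      show "(exp has_derivative (\<lambda>h. h * exp x)) (at x within {..0})" for x :: real by (rule dexp)
    qed (use st M in auto)
    also have "(- 2 * M * s) - (- 2 * M * t) = 2 * M * (t - s)" by (simp add: algebra_simps)
    finally have ex: "\<bar>exp (- 2 * M * s) - exp (- 2 * M * t)\<bar> \<le> 2 * M * dist s t"
      using M by (simp add: dist_real_def abs_mult abs_minus_commute)
    have "w s \<bullet> w s - w t \<bullet> w t = (w s - w t) \<bullet> (w s + w t)"
      by (simp add: inner_add_right inner_diff_left inner_commute[of "w t" "w s"])
    then have "\<bar>w s \<bullet> w s - w t \<bullet> w t\<bar> \<le> norm (w s - w t) * norm (w s + w t)"
      using Cauchy_Schwarz_ineq2 by metis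
    also have "\<dots> \<le> norm (w s - w t) * (2 * B)"
      using B(2)[OF st(1)] B(2)[OF st(2)] norm_triangle_ineq[of "w s" "w t"] by (intro mult_left_mono) auto
    finally have sq: "\<bar>w s \<bullet> w s - w t \<bullet> w t\<bar> \<le> 2 * B * dist (w s) (w t)" by (simp add: dist_norm mult_ac)
    have "g s - g t = exp (- 2 * M * s) * (w s \<bullet> w s - w t \<bullet> w t)
        + (exp (- 2 * M * s) - exp (- 2 * M * t)) * (w t \<bullet> w t)"
      by (simp add: g_def algebra_simps)
    then have "\<bar>g s - g t\<bar> \<le> exp (- 2 * M * s) * \<bar>w s \<bullet> w s - w t \<bullet> w t\<bar>
        + \<bar>exp (- 2 * M * s) - exp (- 2 * M * t)\<bar> * (w t \<bullet> w t)"
      using abs_triangle_ineq[of "exp (- 2 * M * s) * (w s \<bullet> w s - w t \<bullet> w t)"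
          "(exp (- 2 * M * s) - exp (- 2 * M * t)) * (w t \<bullet> w t)"] by (simp add: abs_mult)
    also have "\<dots> \<le> 1 * (2 * B * dist (w s) (w t)) + (2 * M * dist s t) * B\<^sup>2"
    proof (intro add_mono mult_mono sq ex)
      show "w t \<bullet> w t \<le> B\<^sup>2" using B(2)[OF st(2)] by (simp add: dot_square_norm power_mono)
    qed (use st M in auto)
    also have "\<dots> \<le> (2 * B + 2 * M * B\<^sup>2) * (dist (w s) (w t) + dist s t)"
      using B M by (simp add: algebra_simps)
    finally show "dist (g s) (g t) \<le> (2 * B + 2 * M * B\<^sup>2) * (dist (w s) (w t) + dist s t)"
      by (simp add: dist_real_def)
  qed
  then have "absolutely_continuous_on {0..t} g"
    by (rule absolutely_continuous_on_subset) (use t in auto)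
  then have "g t \<le> g 0"
  proof (rule absolutely_continuous_nonincreasing[OF _ _ N])
    fix s assume s: "s \<in> {0..t} - N"
    then obtain D where D: "(w has_vector_derivative D) (at s within {0..T})" "norm D \<le> L * norm (w s)"
      using der[of s] t by auto
    then have D': "(w has_vector_derivative D) (at s within {0..t})"
      using t by (auto intro: has_vector_derivative_within_subset)
    have sq: "((\<lambda>s. w s \<bullet> w s) has_real_derivative 2 * (w s \<bullet> D)) (at s within {0..t})"
      using has_derivative_inner[OF D'[unfolded has_vector_derivative_def] D'[unfolded has_vector_derivative_def]]
      by (simp add: has_field_derivative_def inner_commute mult_ac mult_commute_abs)
    have "(g has_real_derivative exp (- 2 * M * s) * (2 * (w s \<bullet> D)) + (- 2 * M * exp (- 2 * M * s)) * (w s \<bullet> w s))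
        (at s within {0..t})"
      unfolding g_def[abs_def] by (rule derivative_eq_intros sq refl | simp)+
    moreover have "w s \<bullet> D \<le> M * (w s \<bullet> w s)"
    proof -
      have "w s \<bullet> D \<le> norm (w s) * norm D" by (rule norm_cauchy_schwarz)
      also have "\<dots> \<le> norm (w s) * (M * norm (w s))"
        using D(2) M(2)[of "norm (w s)"] by (intro mult_left_mono) auto
      finally show ?thesis by (simp add: dot_square_norm power2_eq_square mult_ac)
    qed
    then have "exp (- 2 * M * s) * (2 * (w s \<bullet> D)) + (- 2 * M * exp (- 2 * M * s)) * (w s \<bullet> w s) \<le> 0"
      by (simp add: algebra_simps)
    ultimately show "\<exists>D. (g has_real_derivative D) (at s within {0..t}) \<and> D \<le> 0" by blast
  qed (use t in auto)
  then have "w t \<bullet> w t \<le> 0" using w0 by (simp add: g_def mult_le_0_iff)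
  then show ?thesis by (metis inner_eq_zero_iff inner_ge_zero order_antisym)
qed

text \<open>The set of \<open>d\<close> with \<open>R \<le> |d|\<close> is not convex, so the bound does not follow from one on the derivative. It is
obtained by writing the Stokeslet through \<open>1 / |d|\<close> and the unit vector along \<open>d\<close>, with Lipschitz constants
\<open>1 / R\<^sup>2\<close> and \<open>2 / R\<close>.\<close>

lemma stokeslet_lipschitz:
  assumes "e \<ge> 0" "R > 0" "R \<le> norm d" "R \<le> norm d'"
  shows "norm (stokeslet e v d - stokeslet e v d') \<le> 6 * e / R\<^sup>2 * norm v * norm (d - d')"
proof -
  define \<rho> \<rho>' where \<rho>: "\<rho> = inverse (norm d)" "\<rho>' = inverse (norm d')"
  define n n' where n: "n = \<rho> *\<^sub>R d" "n' = \<rho>' *\<^sub>R d'"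
  have pos: "norm d > 0" "norm d' > 0" using assms by auto
  have nn: "norm n = 1" "norm n' = 1" using pos by (simp_all add: n \<rho>)
  have \<rho>R: "0 \<le> \<rho>'" "\<rho>' \<le> 1 / R" "0 \<le> \<rho>" "\<rho> \<le> 1 / R"
    using assms pos by (simp_all add: \<rho> inverse_eq_divide frac_le)
  define x where "x = norm (d - d')"
  have eq: "\<rho> - \<rho>' = (norm d' - norm d) * \<rho> * \<rho>'" using pos by (simp add: \<rho> field_simps)
  have dd: "\<bar>norm d' - norm d\<bar> \<le> x" unfolding x_def by (metis norm_minus_commute norm_triangle_ineq3)
  have 1: "\<bar>\<rho> - \<rho>'\<bar> \<le> x / R\<^sup>2"
  proof -
    have "\<bar>\<rho> - \<rho>'\<bar> = \<bar>norm d' - norm d\<bar> * \<rho> * \<rho>'" using \<rho>R by (simp add: eq abs_mult)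
    also have "\<dots> \<le> x * (1 / R) * (1 / R)" using dd \<rho>R assms by (intro mult_mono) (auto simp: x_def)
    finally show ?thesis by (simp add: power2_eq_square)
  qed
  have 2: "norm (n - n') \<le> 2 * x / R"
  proof -
    have "n - n' = \<rho> *\<^sub>R (d - d') + (\<rho> - \<rho>') *\<^sub>R d'" by (simp add: n algebra_simps)
    then have "norm (n - n') \<le> \<rho> * x + \<bar>\<rho> - \<rho>'\<bar> * norm d'"
      using norm_triangle_ineq[of "\<rho> *\<^sub>R (d - d')" "(\<rho> - \<rho>') *\<^sub>R d'"] \<rho>R by (simp add: x_def)
    also have "\<bar>\<rho> - \<rho>'\<bar> * norm d' = \<bar>norm d' - norm d\<bar> * \<rho>"
      using \<rho>R pos by (simp add: eq abs_mult) (simp add: \<rho>)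
    also have "\<rho> * x + \<bar>norm d' - norm d\<bar> * \<rho> \<le> (1 / R) * x + x * (1 / R)"
      using dd \<rho>R assms by (intro add_mono mult_mono) (auto simp: x_def)
    finally show ?thesis by simp
  qed
  have st: "stokeslet e v d = (e * \<rho>) *\<^sub>R v + (e * \<rho> * (n \<bullet> v)) *\<^sub>R n"
    "stokeslet e v d' = (e * \<rho>') *\<^sub>R v + (e * \<rho>' * (n' \<bullet> v)) *\<^sub>R n'"
    by (simp_all add: stokeslet_def n \<rho> power3_eq_cube mult_ac)
  have "stokeslet e v d - stokeslet e v d' = e *\<^sub>R ((\<rho> - \<rho>') *\<^sub>R v + ((\<rho> - \<rho>') * (n \<bullet> v)) *\<^sub>R n
      + (\<rho>' * ((n - n') \<bullet> v)) *\<^sub>R n + (\<rho>' * (n' \<bullet> v)) *\<^sub>R (n - n'))"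
    unfolding st by (simp add: algebra_simps inner_diff_left)
  also have "norm \<dots> \<le> e * (x / R\<^sup>2 * norm v + x / R\<^sup>2 * norm v
      + (1 / R) * (2 * x / R * norm v) + (1 / R) * norm v * (2 * x / R))"
    unfolding norm_scaleR abs_of_nonneg[OF assms(1)]
  proof (intro mult_left_mono order_trans[OF norm_triangle_ineq] add_mono assms(1))
    have cs: "\<bar>u \<bullet> v\<bar> \<le> norm u * norm v" for u by (rule Cauchy_Schwarz_ineq2)
    show "norm ((\<rho> - \<rho>') *\<^sub>R v) \<le> x / R\<^sup>2 * norm v" using mult_right_mono[OF 1, of "norm v"] by simp
    show "norm (((\<rho> - \<rho>') * (n \<bullet> v)) *\<^sub>R n) \<le> x / R\<^sup>2 * norm v"
      unfolding norm_scaleR nn mult_1_right abs_mult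
      using 1 cs[of n] nn by (intro mult_mono) (auto simp: x_def)
    have "\<bar>(n - n') \<bullet> v\<bar> \<le> 2 * x / R * norm v"
      using cs[of "n - n'"] 2 by (meson mult_right_mono norm_ge_zero order_trans)
    then show "norm ((\<rho>' * ((n - n') \<bullet> v)) *\<^sub>R n) \<le> (1 / R) * (2 * x / R * norm v)"
      unfolding norm_scaleR nn mult_1_right abs_mult using \<rho>R assms(2) by (intro mult_mono) auto
    have "\<bar>n' \<bullet> v\<bar> \<le> norm v" using cs[of n'] nn by simp
    then show "norm ((\<rho>' * (n' \<bullet> v)) *\<^sub>R (n - n')) \<le> (1 / R) * norm v * (2 * x / R)"
      unfolding norm_scaleR abs_mult using \<rho>R 2 assms(2) by (intro mult_mono mult_nonneg_nonneg) auto
  qed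
  also have "\<dots> = 6 * e / R\<^sup>2 * norm v * x" using assms(2) by (simp add: field_simps power2_eq_square)
  finally show ?thesis by (simp add: x_def)
qed

lemma AE_interval_negligible:
  fixes T :: real
  assumes "AE t in lebesgue_on {0..T}. P t"
  obtains N where "negligible N" "\<And>t. t \<in> {0..T} - N \<Longrightarrow> P t"
proof -
  have "AE t in lebesgue. t \<in> {0..T} \<longrightarrow> P t"
    using assms by (subst (asm) AE_restrict_space_iff) auto
  then obtain N where "negligible N" "{t. \<not> (t \<in> {0..T} \<longrightarrow> P t)} \<subseteq> N"
    unfolding eventually_ae_filter_negligible by blast
  then show thesis using that by blast
qed

lemma solution_unique:
  assumes a: "a > 0" and R: "R > 0" and u: "u \<in> L_infty T"
    and sol: "is_solution a R T u z0 x y1 y2" and sol': "is_solution a R T u z0 x' y1' y2'"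
    and t: "t \<in> {0..T}"
  shows "x' t = x t \<and> y1' t = y1 t \<and> y2' t = y2 t"
proof -
  obtain M where M: "AE t in lebesgue_on {0..T}. norm (u t) \<le> M" using u by (auto simp: L_infty_def)
  define e where "e = 3 * a / 4"
  have e: "e \<ge> 0" using a by (simp add: e_def)
  define w where "w t = (x' t - x t, y1' t - y1 t, y2' t - y2 t)" for t
  have acz: "absolutely_continuous_on {0..T} (\<lambda>t. (x t, y1 t, y2 t))"
    "absolutely_continuous_on {0..T} (\<lambda>t. (x' t, y1' t, y2' t))"
    and sep: "\<And>t. t \<in> {0..T} \<Longrightarrow> (x t, y1 t, y2 t) \<in> separated R"
    "\<And>t. t \<in> {0..T} \<Longrightarrow> (x' t, y1' t, y2' t) \<in> separated R"
    and init: "(x 0, y1 0, y2 0) = (x' 0, y1' 0, y2' 0)"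
    using sol sol' by (auto simp: is_solution_def AC_def)
  have w_diff: "w t = (x' t, y1' t, y2' t) - (x t, y1 t, y2 t)" for t by (simp add: w_def)
  have acw: "absolutely_continuous_on {0..T} w"
  proof (rule absolutely_continuous_on_dominated[OF acz(2,1) zero_less_one])
    have tri: "dist (p - q) (p' - q') \<le> dist p p' + dist q q'" for p q p' q' :: config
      using norm_triangle_ineq4[of "p - p'" "q - q'"] by (simp add: dist_norm algebra_simps)
    show "dist (w s) (w t) \<le> 1 * (dist (x' s, y1' s, y2' s) (x' t, y1' t, y2' t) + dist (x s, y1 s, y2 s) (x t, y1 t, y2 t))" for s t
      unfolding w_diff mult_1 by (rule tri)
  qed
  have ode: "AE t in lebesgue_on {0..T}.
      (x has_vector_derivative u t) (at t within {0..T}) \<and>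
      (y1 has_vector_derivative mobility a (y1 t - x t) *v u t) (at t within {0..T}) \<and>
      (y2 has_vector_derivative mobility a (y2 t - x t) *v u t) (at t within {0..T})"
    "AE t in lebesgue_on {0..T}.
      (x' has_vector_derivative u t) (at t within {0..T}) \<and>
      (y1' has_vector_derivative mobility a (y1' t - x' t) *v u t) (at t within {0..T}) \<and>
      (y2' has_vector_derivative mobility a (y2' t - x' t) *v u t) (at t within {0..T})"
    using sol sol' by (simp_all add: is_solution_def)
  from eventually_conj[OF M eventually_conj[OF ode]]
  obtain N where N: "negligible N" "\<And>t. t \<in> {0..T} - N \<Longrightarrow> norm (u t) \<le> M \<and>
      ((x has_vector_derivative u t) (at t within {0..T}) \<and>
      (y1 has_vector_derivative mobility a (y1 t - x t) *v u t) (at t within {0..T}) \<and>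
      (y2 has_vector_derivative mobility a (y2 t - x t) *v u t) (at t within {0..T})) \<and>
      ((x' has_vector_derivative u t) (at t within {0..T}) \<and>
      (y1' has_vector_derivative mobility a (y1' t - x' t) *v u t) (at t within {0..T}) \<and>
      (y2' has_vector_derivative mobility a (y2' t - x' t) *v u t) (at t within {0..T}))"
    by (rule AE_interval_negligible) (rule that)
  define K where "K = 6 * e / R\<^sup>2 * max M 0"
  have K: "K \<ge> 0" using e by (simp add: K_def)
  have "w t = 0"
  proof (rule gronwall_zero[OF acw _ N(1) _ t])
    show "w 0 = 0" using init by (simp add: w_def zero_prod_def)
    fix t assume t: "t \<in> {0..T} - N"
    note N2 = N(2)[OF t, folded e_def, unfolded mobility_eq_stokeslet, folded e_def]
    define D1 D2 where "D1 = stokeslet e (u t) (y1' t - x' t) - stokeslet e (u t) (y1 t - x t)"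
      and "D2 = stokeslet e (u t) (y2' t - x' t) - stokeslet e (u t) (y2 t - x t)"
    have "(w has_vector_derivative (u t - u t, D1, D2)) (at t within {0..T})"
      unfolding w_def[abs_def] D1_def D2_def using N2
      by (intro has_vector_derivative_Pair has_vector_derivative_diff) auto
    moreover have "norm (u t - u t, D1, D2) \<le> 4 * K * norm (w t)"
    proof -
      have bound: "norm (stokeslet e (u t) d - stokeslet e (u t) d') \<le> K * norm (d - d')"
        if "R \<le> norm d" "R \<le> norm d'" for d d'
      proof -
        have "norm (u t) \<le> max M 0" using N2 by linarith
        then have "6 * e / R\<^sup>2 * norm (u t) * norm (d - d') \<le> K * norm (d - d')"
          unfolding K_def using e by (intro mult_right_mono mult_left_mono) auto
        then show ?thesis using stokeslet_lipschitz[OF e R that, of "u t"] by linarith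
      qed
      have comps: "norm (x' t - x t) \<le> norm (w t)" "norm (y1' t - y1 t) \<le> norm (w t)" "norm (y2' t - y2 t) \<le> norm (w t)"
        unfolding w_def using norm_fst_le norm_snd_le by (metis order_trans)+
      have "norm D1 \<le> K * norm ((y1' t - x' t) - (y1 t - x t))"
        unfolding D1_def using sep[of t] t by (intro bound) (auto simp: separated_def norm_minus_commute)
      also have "\<dots> \<le> K * (2 * norm (w t))"
        using comps norm_triangle_ineq4[of "y1' t - y1 t" "x' t - x t"] K
        by (intro mult_left_mono) (simp_all add: algebra_simps)
      finally have d1: "norm D1 \<le> 2 * K * norm (w t)" by simp
      have "norm D2 \<le> K * norm ((y2' t - x' t) - (y2 t - x t))"
        unfolding D2_def using sep[of t] t by (intro bound) (auto simp: separated_def norm_minus_commute)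
      also have "\<dots> \<le> K * (2 * norm (w t))"
        using comps norm_triangle_ineq4[of "y2' t - y2 t" "x' t - x t"] K
        by (intro mult_left_mono) (simp_all add: algebra_simps)
      finally have d2: "norm D2 \<le> 2 * K * norm (w t)" by simp
      have "norm (u t - u t, D1, D2) \<le> norm D1 + norm D2"
        using norm_Pair_le[of D1 D2] by (simp add: norm_Pair)
      then show ?thesis using d1 d2 by simp
    qed
    ultimately show "\<exists>D. (w has_vector_derivative D) (at t within {0..T}) \<and> norm D \<le> 4 * K * norm (w t)" by blast
  qed
  then show ?thesis by (simp add: w_def zero_prod_def)
qed

section \<open>Steering by piecewise constant controls\<close>

text \<open>Stronger than what is demanded of a solution, in order that concatenation is immediate: the control is bounded and Borel measurable on the
whole line, the curve is Lipschitz, and the equation fails at finitely many times at most.\<close>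

definition steers :: "real \<Rightarrow> real \<Rightarrow> config \<Rightarrow> config \<Rightarrow> bool"
  where "steers e R z w \<longleftrightarrow> (\<exists>T>0. \<exists>u c L M F.
    u \<in> borel_measurable borel \<and> (\<forall>t. norm (u t) \<le> M) \<and>
    L-lipschitz_on {0..T} c \<and> (\<forall>t\<in>{0..T}. c t \<in> separated R) \<and> c 0 = z \<and> c T = w \<and> finite F \<and>
    (\<forall>t\<in>{0..T} - F. (c has_vector_derivative lift_field (u t) (stokeslet e (u t)) (c t)) (at t within {0..T})))"

lemma steersI:
  assumes "T > 0" "u \<in> borel_measurable borel" "\<And>t. norm (u t) \<le> M" "L-lipschitz_on {0..T} c"
    "\<And>t. t \<in> {0..T} \<Longrightarrow> c t \<in> separated R" "c 0 = z" "c T = w" "finite F"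
    "\<And>t. t \<in> {0..T} - F \<Longrightarrow>
      (c has_vector_derivative lift_field (u t) (stokeslet e (u t)) (c t)) (at t within {0..T})"
  shows "steers e R z w"
  unfolding steers_def using assms by blast

lemma steers_refl:
  assumes "z \<in> separated R"
  shows "steers e R z z"
proof (rule steersI[where T = 1 and u = "\<lambda>_. 0" and c = "\<lambda>_. z" and M = 0 and L = 0 and F = "{}"])
  have "lift_field 0 (stokeslet e 0) z = 0" by (simp add: lift_field_def stokeslet_def zero_prod_def)
  then show "((\<lambda>_. z) has_vector_derivative lift_field 0 (stokeslet e 0) z) (at t within {0..1})" for t
    by simp
qed (use assms in \<open>auto intro: lipschitz_on_constant\<close>)

lemma steers_trans:
  assumes "steers e R z y" "steers e R y w"
  shows "steers e R z w"
proof -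
  obtain T1 u1 c1 L1 M1 F1 where 1: "T1 > 0" "u1 \<in> borel_measurable borel" "\<And>t. norm (u1 t) \<le> M1"
    "L1-lipschitz_on {0..T1} c1" "\<And>t. t \<in> {0..T1} \<Longrightarrow> c1 t \<in> separated R" "c1 0 = z" "c1 T1 = y" "finite F1"
    "\<And>t. t \<in> {0..T1} - F1 \<Longrightarrow>
      (c1 has_vector_derivative lift_field (u1 t) (stokeslet e (u1 t)) (c1 t)) (at t within {0..T1})"
    using assms(1) unfolding steers_def by blast
  obtain T2 u2 c2 L2 M2 F2 where 2: "T2 > 0" "u2 \<in> borel_measurable borel" "\<And>t. norm (u2 t) \<le> M2"
    "L2-lipschitz_on {0..T2} c2" "\<And>t. t \<in> {0..T2} \<Longrightarrow> c2 t \<in> separated R" "c2 0 = y" "c2 T2 = w" "finite F2"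
    "\<And>t. t \<in> {0..T2} - F2 \<Longrightarrow>
      (c2 has_vector_derivative lift_field (u2 t) (stokeslet e (u2 t)) (c2 t)) (at t within {0..T2})"
    using assms(2) unfolding steers_def by blast
  define u where "u t = (if t < T1 then u1 t else u2 (t - T1))" for t
  define c where "c t = (if t \<le> T1 then c1 t else c2 (t - T1))" for t
  define F where "F = insert T1 (F1 \<union> (\<lambda>t. t + T1) ` F2)"
  let ?T = "T1 + T2"
  have "L2-lipschitz_on {T1..?T} (\<lambda>t. c2 (t - T1))"
  proof (rule lipschitz_onI)
    show "dist (c2 (s - T1)) (c2 (t - T1)) \<le> L2 * dist s t" if "s \<in> {T1..?T}" "t \<in> {T1..?T}" for s t
      using lipschitz_onD[OF 2(4), of "s - T1" "t - T1"] that by (simp add: dist_real_def)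
  qed (use lipschitz_on_nonneg[OF 2(4)] in simp)
  from lipschitz_on_concat_max[OF 1(4) this] have lip: "(max L1 L2)-lipschitz_on {0..?T} c"
    using 1 2 by (simp add: c_def[abs_def])
  have der: "(c has_vector_derivative lift_field (u t) (stokeslet e (u t)) (c t)) (at t within {0..?T})"
    if t: "t \<in> {0..?T} - F" for t
  proof (cases "t < T1")
    case True
    have "at t within {0..T1} = at t within {0..?T}"
      by (rule at_within_nhd[of _ "{..<T1}"]) (use True 2(1) in auto)
    then have "(c1 has_vector_derivative lift_field (u t) (stokeslet e (u t)) (c t)) (at t within {0..?T})"
      using 1(9)[of t] t True by (simp add: u_def c_def F_def)
    then show ?thesis
      by (rule has_vector_derivative_transform_within[of _ _ _ _ "T1 - t"])
        (use t True in \<open>auto simp: c_def dist_real_def\<close>)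
  next
    case False
    with t have T1t: "T1 < t" by (auto simp: F_def)
    have im: "(\<lambda>s. s - T1) ` {T1..?T} = {0..T2}"
      by (auto simp: image_iff intro: bexI[of _ "_ + T1"])
    have "t - T1 \<notin> F2" using t by (auto simp: F_def image_iff)
    then have "(c2 has_vector_derivative lift_field (u2 (t - T1)) (stokeslet e (u2 (t - T1))) (c2 (t - T1)))
        (at (t - T1) within (\<lambda>s. s - T1) ` {T1..?T})"
      unfolding im using 2(9)[of "t - T1"] t T1t by auto
    moreover have "((\<lambda>s. s - T1) has_vector_derivative 1) (at t within {T1..?T})"
      by (auto intro!: derivative_eq_intros)
    ultimately have "(c2 \<circ> (\<lambda>s. s - T1) has_vector_derivative
        1 *\<^sub>R lift_field (u2 (t - T1)) (stokeslet e (u2 (t - T1))) (c2 (t - T1))) (at t within {T1..?T})"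
      by (intro vector_diff_chain_within)
    moreover have "at t within {T1..?T} = at t within {0..?T}"
      by (rule at_within_nhd[of _ "{T1<..}"]) (use T1t 1(1) in auto)
    ultimately have "((\<lambda>s. c2 (s - T1)) has_vector_derivative lift_field (u t) (stokeslet e (u t)) (c t)) (at t within {0..?T})"
      using T1t by (simp add: u_def c_def comp_def)
    then show ?thesis
      by (rule has_vector_derivative_transform_within[of _ _ _ _ "t - T1"])
        (use t T1t in \<open>auto simp: c_def dist_real_def\<close>)
  qed
  have meas: "u \<in> borel_measurable borel"
    unfolding u_def[abs_def] using 1(2) 2(2) by measurable
  have bound: "norm (u t) \<le> max M1 M2" for t
    using 1(3)[of t] 2(3)[of "t - T1"] by (auto simp: u_def)
  show ?thesis
  proof (rule steersI[where F = F, OF _ meas bound lip])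
    show "c t \<in> separated R" if "t \<in> {0..?T}" for t
      using 1(5)[of t] 2(5)[of "t - T1"] that by (auto simp: c_def)
  qed (use 1(1,6,7,8) 2(1,6,7,8) der in \<open>auto simp: c_def F_def\<close>)
qed

lemma (in stokes_system) steers_step:
  assumes "step z w"
  shows "steers e R z w"
proof -
  obtain v c where c: "integral_curve (separated R) (lift_field v (stokeslet e v)) c" "c 0 = z" "c 1 = w"
    using assms unfolding step_def by (auto simp: stokes_fields_def)
  let ?Y = "lift_field v (stokeslet e v)"
  have sep: "c t \<in> separated R" and der: "(c has_vector_derivative ?Y (c t)) (at t within {0..1})"
    if "t \<in> {0..1}" for t using c(1) that by (auto simp: integral_curve_def)
  have "(?Y has_derivative stokes_field_deriv e v q) (at q within separated R)" if "q \<in> separated R" for q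
    using has_derivative_stokes_field[OF rel_nonzero(3,4)[OF that R_pos]] by (rule has_derivative_at_withinI)
  then have "continuous_on (separated R) ?Y" by (rule has_derivative_continuous_on)
  moreover have "continuous_on {0..1} c" using der by (rule continuous_on_vector_derivative)
  ultimately have "continuous_on {0..1} (\<lambda>t. ?Y (c t))"
    by (rule continuous_on_compose2) (use sep in auto)
  then have "compact ((\<lambda>t. ?Y (c t)) ` {0..1})"
    by (rule compact_continuous_image) simp
  then obtain B where B: "B > 0" "\<And>t. t \<in> {0..1} \<Longrightarrow> norm (?Y (c t)) \<le> B"
    using compact_imp_bounded by (metis (no_types, lifting) bounded_pos imageI)
  have "B-lipschitz_on {0..1} c"
  proof (rule bounded_derivative_imp_lipschitz)
    show "(c has_derivative (\<lambda>s. s *\<^sub>R ?Y (c t))) (at t within {0..1})" if "t \<in> {0..1}" for t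
      using der[OF that] by (simp add: has_vector_derivative_def)
    show "onorm (\<lambda>s. s *\<^sub>R ?Y (c t)) \<le> B" if "t \<in> {0..1}" for t
      by (rule onorm_le) (use mult_left_mono[OF B(2)[OF that] abs_ge_zero] in \<open>simp add: mult.commute\<close>)
  qed (use B in auto)
  then show ?thesis
    by (intro steersI[where T = 1 and u = "\<lambda>_. v" and c = c and M = "norm v" and F = "{}"])
      (use c sep der in auto)
qed

lemma (in stokes_system) steers_if_reach:
  assumes "reach z w" "z \<in> separated R"
  shows "steers e R z w"
  using assms by induction (auto intro: steers_refl steers_trans steers_step)

lemma solution_if_steers:
  assumes "steers (3 * a / 4) R z w"
  obtains T u x y1 y2 where "T > 0" "u \<in> L_infty T" "is_solution a R T u z x y1 y2" "(x T, y1 T, y2 T) = w"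
proof -
  obtain T u c L M F where s: "T > 0" "u \<in> borel_measurable borel" "\<And>t. norm (u t) \<le> M"
    "L-lipschitz_on {0..T} c" "\<And>t. t \<in> {0..T} \<Longrightarrow> c t \<in> separated R" "c 0 = z" "c T = w" "finite F"
    "\<And>t. t \<in> {0..T} - F \<Longrightarrow>
      (c has_vector_derivative lift_field (u t) (stokeslet (3 * a / 4) (u t)) (c t)) (at t within {0..T})"
    using assms unfolding steers_def by blast
  define x y1 y2 where "x t = fst (c t)" and "y1 t = fst (snd (c t))" and "y2 t = snd (snd (c t))" for t
  have cxy: "(x t, y1 t, y2 t) = c t" for t by (simp add: x_def y1_def y2_def)
  have u: "u \<in> L_infty T"
  proof -
    have "u \<in> borel_measurable lebesgue" using s(2) by (simp add: measurable_completion)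
    then have "u \<in> borel_measurable (lebesgue_on {0..T})" by (rule measurable_restrict_space1)
    then show ?thesis using s(3) by (auto simp: L_infty_def)
  qed
  have ode: "(x has_vector_derivative u t) (at t within {0..T}) \<and>
      (y1 has_vector_derivative mobility a (y1 t - x t) *v u t) (at t within {0..T}) \<and>
      (y2 has_vector_derivative mobility a (y2 t - x t) *v u t) (at t within {0..T})"
    if "t \<in> {0..T} - F" for t
  proof -
    note d = s(9)[OF that]
    note f = bounded_linear.has_vector_derivative[OF bounded_linear_fst]
      and g = bounded_linear.has_vector_derivative[OF bounded_linear_snd]
    show ?thesis
      unfolding x_def y1_def y2_def mobility_eq_stokeslet
      using f[OF d] f[OF g[OF d]] g[OF g[OF d]] by (simp add: lift_field_def rel1_def rel2_def)
  qed
  have "is_solution a R T u z x y1 y2"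
    unfolding is_solution_def cxy AC_def
  proof (intro conjI)
    have "AE t in lebesgue. t \<in> {0..T} \<longrightarrow> (x has_vector_derivative u t) (at t within {0..T}) \<and>
      (y1 has_vector_derivative mobility a (y1 t - x t) *v u t) (at t within {0..T}) \<and>
      (y2 has_vector_derivative mobility a (y2 t - x t) *v u t) (at t within {0..T})"
      unfolding eventually_ae_filter_negligible
      using ode s(8) by (intro exI[of _ F] conjI) (auto intro: negligible_finite)
    then show "AE t in lebesgue_on {0..T}. (x has_vector_derivative u t) (at t within {0..T}) \<and>
      (y1 has_vector_derivative mobility a (y1 t - x t) *v u t) (at t within {0..T}) \<and>
      (y2 has_vector_derivative mobility a (y2 t - x t) *v u t) (at t within {0..T})"
      by (subst AE_restrict_space_iff) auto
  qed (use s absolutely_continuous_on_lipschitz[OF s(4)] in auto)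
  then show thesis using that s(1,7) u cxy by blast
qed

text \<open>The constant is \<open>2\<close>: with \<open>e = 3 * a / 4\<close>, the condition \<open>2 e < R\<close> reads \<open>3 a / 2 < R\<close>.\<close>

theorem theorem4p2:
  shows "\<exists>C::real. C \<ge> 2 \<and>
    (\<forall>a R. a > 0 \<longrightarrow> R > C * a \<longrightarrow>
      (\<forall>z0 \<in> separated R. \<forall>zf \<in> separated R.
        \<exists>T>0. \<exists>u \<in> L_infty T. \<exists>x y1 y2.
          is_solution a R T u z0 x y1 y2 \<and>
          (\<forall>x' y1' y2'. is_solution a R T u z0 x' y1' y2' \<longrightarrow>
            (\<forall>t\<in>{0..T}. x' t = x t \<and> y1' t = y1 t \<and> y2' t = y2 t)) \<and>
          (x T, y1 T, y2 T) = zf))"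
proof (rule exI[of _ "2::real"], intro conjI allI impI ballI)
  fix a R :: real and z0 zf
  assume a: "a > 0" and R: "R > 2 * a" and z: "z0 \<in> separated R" "zf \<in> separated R"
  have "R > 0" using a R by simp
  interpret stokes_system "3 * a / 4" R
    by unfold_locales (use a R in auto)
  have "steers (3 * a / 4) R z0 zf"
    by (intro steers_if_reach reach_all z)
  then obtain T u x y1 y2 where sol: "T > 0" "u \<in> L_infty T" "is_solution a R T u z0 x y1 y2" "(x T, y1 T, y2 T) = zf"
    by (rule solution_if_steers)
  then show "\<exists>T>0. \<exists>u \<in> L_infty T. \<exists>x y1 y2.
          is_solution a R T u z0 x y1 y2 \<and>
          (\<forall>x' y1' y2'. is_solution a R T u z0 x' y1' y2' \<longrightarrow>
            (\<forall>t\<in>{0..T}. x' t = x t \<and> y1' t = y1 t \<and> y2' t = y2 t)) \<and>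
          (x T, y1 T, y2 T) = zf"
    using solution_unique[OF a \<open>R > 0\<close> sol(2,3)] by blast
qed simp

end
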